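(* A function $q\colon \mathbb{C}^{+2}\to\mathbb{C}$ is a Herglotz-Nevanlinna function in two variables if and only if $q$ can be written as $$q(z_1,z_2) = a + b_1 z_1 + b_2 z_2 + \frac{1}{\pi^2}\iint_{\mathbb{R}^2}K\big((z_1,z_2),(t_1,t_2)\big)\,\mathrm{d}\mu(t_1,t_2),\qquad (z_1,z_2)\in\mathbb{C}^{+2},$$ where $a\in\mathbb{R}$, $b_1,b_2\ge 0$, and $\mu$ is a positive Borel measure on $\mathbb{R}^2$ satisfying the growth condition $$\iint_{\mathbb{R}^2}\frac{1}{(1+t_1^2)(1+t_2^2)}\,\mathrm{d}\mu(t_1,t_2)<\infty$$ and the Nevanlinna condition $$\iint_{\mathbb{R}^2}\mathrm{Re}\left[\left(\frac{1}{t_1-\overline{z_1}}-\frac{1}{t_1+\mathrm{i}}\right)\left(\frac{1}{t_2-z_2}-\frac{1}{t_2-\mathrm{i}}\right)\right]\mathrm{d}\mu(t_1,t_2)=0$$ for all $(z_1,z_2)\in\mathbb{C}^{+2}$.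
   Context: $\mathbb{C}^{+2}:=\{(z_1,z_2)\in\mathbb{C}^2 : \mathrm{Im}[z_1]>0,\ \mathrm{Im}[z_2]>0\}$. A Herglotz-Nevanlinna function in two variables is a holomorphic function $q\colon\mathbb{C}^{+2}\to\mathbb{C}$ with non-negative imaginary part. The kernel $K$ is defined for $(z_1,z_2)\in\mathbb{C}^{+2}$ and $(t_1,t_2)\in\mathbb{R}^2$ by $$K\big((z_1,z_2),(t_1,t_2)\big):=-\frac{\mathrm{i}}{2}\left(\frac{1}{t_1-z_1}-\frac{1}{t_1+\mathrm{i}}\right)\left(\frac{1}{t_2-z_2}-\frac{1}{t_2+\mathrm{i}}\right)-\frac{\mathrm{i}}{(1+t_1^2)(1+t_2^2)}.$$ *)

theory Defs
  imports "HOL-Analysis.Analysis"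
begin

definition upper_half_plane2 :: "(complex \<times> complex) set" where
  "upper_half_plane2 = {(z1, z2). Im z1 > 0 \<and> Im z2 > 0}"

text \<open>
  Holomorphy in two variables is complex Frechet differentiability: at every point the
  real derivative exists and is complex-linear, hence given by two complex numbers.
\<close>

definition holomorphic2_on :: "(complex \<times> complex \<Rightarrow> complex) \<Rightarrow> (complex \<times> complex) set \<Rightarrow> bool" where
  "holomorphic2_on f S \<longleftrightarrow>
     (\<forall>z\<in>S. \<exists>c1 c2. (f has_derivative (\<lambda>(h1, h2). c1 * h1 + c2 * h2)) (at z within S))"

text \<open>
  The function is total in HOL; only its values on the poly-upper half-plane matter.
\<close>

definition herglotz_nevanlinna2 :: "(complex \<times> complex \<Rightarrow> complex) \<Rightarrow> bool" where
  "herglotz_nevanlinna2 q \<longleftrightarrow>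
     holomorphic2_on q upper_half_plane2 \<and> (\<forall>z\<in>upper_half_plane2. Im (q z) \<ge> 0)"

definition kernel2 :: "complex \<times> complex \<Rightarrow> real \<times> real \<Rightarrow> complex" where
  "kernel2 = (\<lambda>(z1, z2) (t1, t2).
     - (\<i> / 2) * (1 / (of_real t1 - z1) - 1 / (of_real t1 + \<i>))
              * (1 / (of_real t2 - z2) - 1 / (of_real t2 + \<i>))
     - \<i> / of_real ((1 + t1\<^sup>2) * (1 + t2\<^sup>2)))"

definition growth_condition2 :: "(real \<times> real) measure \<Rightarrow> bool" where
  "growth_condition2 \<mu> \<longleftrightarrow>
     (\<integral>\<^sup>+ (t1, t2). ennreal (1 / ((1 + t1\<^sup>2) * (1 + t2\<^sup>2))) \<partial>\<mu>) < \<infinity>"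

text \<open>
  For a Borel measure satisfying the growth condition, the integrand below and the kernel
  above are integrable for every point of the poly-upper half-plane, so the convention
  that the Bochner integral of a non-integrable function is zero plays no role.
\<close>

definition nevanlinna_condition2 :: "(real \<times> real) measure \<Rightarrow> bool" where
  "nevanlinna_condition2 \<mu> \<longleftrightarrow>
     (\<forall>(z1, z2)\<in>upper_half_plane2.
        (\<integral>(t1, t2). Re ((1 / (of_real t1 - cnj z1) - 1 / (of_real t1 + \<i>))
                     * (1 / (of_real t2 - z2) - 1 / (of_real t2 - \<i>))) \<partial>\<mu>) = 0)"

end

theory Submission
  imports Defs "HOL-Complex_Analysis.Complex_Analysis" "HOL-Probability.Probability"
begin

text \<open>
  Why the theorem is true. The Cayley transform w = (z - i) / (z + i) turns q into the function
  f = - i q on the bidisc, and Im q \<ge> 0 becomes Re f \<ge> 0. Under the boundary correspondence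
  \<zeta> = (t - i) / (t + i), the two kernels of the theorem are Szego kernels in disguise. With
  C = 1 / (1 - w cnj \<zeta>) in each variable, the kernel K times (1 + t1^2) (1 + t2^2) is
  i (2 C1 C2 - 1), and the integrand of the Nevanlinna condition times the same factor is
  4 Re (cnj (C1 - 1) (C2 - 1)) (lemma boundary_weight_kernels). So the theorem is a statement
  about the measures on the torus that represent functions with non-negative real part on the
  bidisc.

  On the bidisc, Cauchy's formula, applied to the dilates f (r w) and their conjugates, recovers f
  from the densities Re f (r \<zeta>) on the torus and shows that all mixed Fourier coefficients of
  these densities vanish: neither a holomorphic nor an antiholomorphic function has frequencies of
  opposite sign (lemma torus_integrals_Re). All these densities have the mass Re f (0, 0), so by
  weak compactness a subsequence for r \<rightarrow> 1 converges to a measure \<nu> on the torus,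
  and both facts survive in the limit (lemma herglotz_bidisc). Weak compactness on the square is
  reduced to Helly's theorem on the line: a Peano curve g has a Borel right inverse s, the measures
  are moved to the line by s, and the limit is moved back by the continuous map g (lemma
  helly_unit_square).

  The plane corresponds to the torus without the two faces \<zeta>1 = 1 and \<zeta>2 = 1. Letting
  w1 \<rightarrow> 1 radially in the mixed moment condition isolates the face \<zeta>1 = 1 and shows
  that the mass of \<nu> on it is uniform in the second variable; in particular the corner (1, 1)
  carries no mass (lemma face_mass_is_uniform). Hence a face contributes nothing to the mixed
  moments, and it contributes exactly the linear term b z to q, where b is its mass. The rest of
  \<nu>, moved to the plane and multiplied by \<pi>^2 (1 + t1^2) (1 + t2^2), is the measure \<mu> of the
  theorem.

  Conversely, Im K is the product of two Poisson kernels minus half of the integrand of the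
  Nevanlinna condition, pointwise (lemma Im_kernel2), so the imaginary part of the representing
  formula is non-negative. The kernel has a first order Taylor expansion in z whose remainder is
  quadratic and dominated by the growth weight, which allows differentiation under the integral
  (lemma kernel_integral_quadratic_remainder).
\<close>

section \<open>Cauchy integrals over the torus\<close>

text \<open>
  The Szego kernel 1 / (1 - w cnj \<zeta>) of the unit disc at the boundary point \<zeta> = cis (2 \<pi> \<theta>). The
  angle is the argument, so that integrals over the torus become integrals over the unit square.
\<close>

definition szego :: "complex \<Rightarrow> real \<Rightarrow> complex" where
  "szego w \<theta> = 1 / (1 - w * cis (- (2 * pi * \<theta>)))"

lemma szego_denominator_bound: "1 - norm w \<le> norm (1 - w * cis x)"
proof -
  have "norm (1::complex) - norm (w * cis x) \<le> norm (1 - w * cis x)"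
    by (rule norm_triangle_ineq2)
  then show ?thesis by (simp add: norm_mult)
qed

lemma szego_denominator_nonzero: "norm w < 1 \<Longrightarrow> 1 - w * cis x \<noteq> 0"
  using szego_denominator_bound[of w x] by auto

lemma norm_szego_le:
  assumes "norm w < 1" shows "norm (szego w \<theta>) \<le> 1 / (1 - norm w)"
  using szego_denominator_bound[of w "- (2 * pi * \<theta>)"] assms
  by (simp add: szego_def norm_divide frac_le)

lemma szego_0 [simp]: "szego 0 \<theta> = 1"
  by (simp add: szego_def)

lemma cnj_szego: "cnj (szego w \<theta>) = 1 / (1 - cnj w * cis (2 * pi * \<theta>))"
  by (simp add: szego_def cis_cnj)

lemma continuous_on_szego:
  assumes "norm w < 1" "continuous_on S g"
  shows "continuous_on S (\<lambda>x. szego w (g x))"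
  unfolding szego_def using szego_denominator_nonzero[OF assms(1)]
  by (intro continuous_intros assms(2)) auto

lemma szego_measurable [measurable]: "szego w \<in> borel_measurable borel"
  unfolding szego_def cis.code complex_eq_iff Complex_eq by measurable

lemma cauchy_on_unit_circle:
  assumes "continuous_on (cball 0 1) g" "g holomorphic_on ball 0 1" "norm w < 1"
  shows "((\<lambda>\<theta>. g (cis (2*pi*\<theta>)) * szego w \<theta>) has_integral g w) {0..1}"
proof -
  have "((\<lambda>u. g u/(u-w)) has_contour_integral (2 * of_real pi * \<i> * g w)) (circlepath 0 1)"
    by (rule Cauchy_integral_circlepath) (use assms in auto)
  then have "((\<lambda>x. g (circlepath 0 1 x)/(circlepath 0 1 x-w) * (2 * pi * \<i> * exp (2 * pi * \<i> * x)))
     has_integral (2 * of_real pi * \<i> * g w)) {0..1}"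
    unfolding has_contour_integral_def
    by (rule has_integral_eq[rotated]) (simp add: vector_derivative_circlepath01)
  then have "((\<lambda>x. g (circlepath 0 1 x)/(circlepath 0 1 x-w) * (2 * pi * \<i> * exp (2 * pi * \<i> * x)) / (2 * pi * \<i>))
     has_integral (2 * of_real pi * \<i> * g w / (2 * pi * \<i>))) {0..1}"
    by (rule has_integral_divide)
  moreover have "g (circlepath 0 1 x)/(circlepath 0 1 x-w) * (2 * pi * \<i> * exp (2 * pi * \<i> * x)) / (2 * pi * \<i>)
     = g (cis (2*pi*x)) * szego w x" for x
  proof -
    have e: "circlepath 0 1 x = cis (2*pi*x)" "exp (2 * pi * \<i> * x) = cis (2*pi*x)"
      by (simp_all add: circlepath cis_conv_exp mult_ac)
    have "szego w x = cis (2*pi*x) / (cis (2*pi*x) * (1 - w * cis (-(2*pi*x))))"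
      by (simp add: szego_def)
    also have "cis (2*pi*x) * (1 - w * cis (-(2*pi*x))) = cis (2*pi*x) - w"
      by (simp add: algebra_simps cis_mult)
    finally show ?thesis unfolding e by simp
  qed
  ultimately show ?thesis by simp
qed

text \<open>
  Since cnj \<zeta> = 1 / \<zeta> on the circle, the conjugate kernel is the boundary value of the holomorphic
  function 1 / (1 - cnj w \<zeta>), whose value at 0 is 1, so the mean value property applies.
\<close>

lemma cauchy_on_unit_circle_cnj:
  assumes "continuous_on (cball 0 1) g" "g holomorphic_on ball 0 1" "norm w < 1"
  shows "((\<lambda>\<theta>. g (cis (2*pi*\<theta>)) * cnj (szego w \<theta>)) has_integral g 0) {0..1}"
proof -
  have nz: "1 - cnj w * u \<noteq> 0" if "norm u \<le> 1" for u
  proof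
    assume "1 - cnj w * u = 0"
    then have "norm (cnj w * u) = 1" by simp
    then show False using that assms(3) mult_mono[of "norm w" "norm w" "norm u" 1] by (simp add: norm_mult)
  qed
  have "((\<lambda>\<theta>. (\<lambda>u. g u * (1 / (1 - cnj w * u))) (cis (2*pi*\<theta>)) * szego 0 \<theta>)
     has_integral (\<lambda>u. g u * (1 / (1 - cnj w * u))) 0) {0..1}"
    by (rule cauchy_on_unit_circle) (use nz in \<open>auto intro!: continuous_intros holomorphic_intros assms\<close>)
  then show ?thesis by (simp add: cnj_szego)
qed

text \<open>
  Continuity and holomorphy in each variable separately: this is the form in which the iterated
  one-variable Cauchy formula consumes holomorphy.
\<close>

definition bidisc_holomorphic where
  "bidisc_holomorphic R g \<longleftrightarrow> continuous_on (ball 0 R \<times> ball 0 R) (g :: complex \<times> complex \<Rightarrow> complex)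
    \<and> (\<forall>w\<in>ball 0 R. (\<lambda>u. g (u, w)) holomorphic_on ball 0 R \<and> (\<lambda>u. g (w, u)) holomorphic_on ball 0 R)"

definition torus_point :: "real \<times> real \<Rightarrow> complex \<times> complex" where
  "torus_point p = (cis (2 * pi * fst p), cis (2 * pi * snd p))"

lemma torus_integrals:
  assumes g: "bidisc_holomorphic R g" "R > 1" and w: "norm w1 < 1" "norm w2 < 1"
  shows "((\<lambda>p. g (torus_point p) * (szego w1 (fst p) * szego w2 (snd p)))
           has_integral g (w1, w2)) (cbox (0,0) (1,1))"
    and "((\<lambda>p. g (torus_point p) * (cnj (szego w1 (fst p)) * cnj (szego w2 (snd p))))
           has_integral g (0, 0)) (cbox (0,0) (1,1))"
    and "((\<lambda>p. g (torus_point p) * (szego w1 (fst p) * cnj (szego w2 (snd p))))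
           has_integral g (w1, 0)) (cbox (0,0) (1,1))"
    and "((\<lambda>p. g (torus_point p) * (cnj (szego w1 (fst p)) * szego w2 (snd p)))
           has_integral g (0, w2)) (cbox (0,0) (1,1))"
proof -
  have ct: "continuous_on UNIV (\<lambda>p. g (torus_point p))"
  proof (rule continuous_on_compose2[where g=g and t="ball 0 R \<times> ball 0 R"])
    show "continuous_on UNIV torus_point"
      unfolding torus_point_def by (intro continuous_intros)
  qed (use g in \<open>auto simp: bidisc_holomorphic_def torus_point_def\<close>)
  have sub: "continuous_on (cball 0 1) (\<lambda>u. g (u, w)) \<and> (\<lambda>u. g (u, w)) holomorphic_on ball 0 1 \<and>
    continuous_on (cball 0 1) (\<lambda>u. g (w, u)) \<and> (\<lambda>u. g (w, u)) holomorphic_on ball 0 1"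
    if "norm w \<le> 1" for w
  proof -
    have "w \<in> ball 0 R" using that g(2) by auto
    then have "(\<lambda>u. g (u, w)) holomorphic_on ball 0 R" "(\<lambda>u. g (w, u)) holomorphic_on ball 0 R"
      using g(1) by (auto simp: bidisc_holomorphic_def)
    moreover have "cball 0 1 \<subseteq> ball (0::complex) R" "ball 0 1 \<subseteq> ball (0::complex) R" using g(2) by auto
    ultimately show ?thesis
      by (meson holomorphic_on_imp_continuous_on holomorphic_on_subset)
  qed
  have key: "((\<lambda>p. g (torus_point p) * (a (fst p) * b (snd p))) has_integral y) (cbox (0,0) (1,1))"
    if ab: "continuous_on UNIV a" "continuous_on UNIV b"
      and A: "\<And>\<theta>. ((\<lambda>\<eta>. g (cis (2*pi*\<theta>), cis (2*pi*\<eta>)) * b \<eta>) has_integral G \<theta>) {0..1}"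
      and B: "((\<lambda>\<theta>. G \<theta> * a \<theta>) has_integral y) {0..1}" for a b y G
  proof -
    have c: "continuous_on (cbox (0,0) (1,1)) (\<lambda>p. g (torus_point p) * (a (fst p) * b (snd p)))"
      by (intro continuous_intros continuous_on_compose2[OF ab(1)] continuous_on_compose2[OF ab(2)]
        continuous_on_subset[OF ct]) auto
    have "integral {0..1} (\<lambda>\<eta>. g (torus_point (\<theta>, \<eta>)) * (a (fst (\<theta>, \<eta>)) * b (snd (\<theta>, \<eta>)))) = G \<theta> * a \<theta>" for \<theta>
      using has_integral_mult_left[OF A[of \<theta>], of "a \<theta>"]
      by (intro integral_unique) (simp add: torus_point_def mult_ac)
    then have "integral (cbox (0,0) (1,1)) (\<lambda>p. g (torus_point p) * (a (fst p) * b (snd p))) = y"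
      unfolding integral_prod_continuous[OF c] using B by (simp add: integral_unique)
    then show ?thesis using c integrable_continuous by (metis has_integral_integral)
  qed
  have cs: "continuous_on UNIV (szego w1)" "continuous_on UNIV (\<lambda>x. cnj (szego w1 x))"
     "continuous_on UNIV (szego w2)" "continuous_on UNIV (\<lambda>x. cnj (szego w2 x))"
    using w by (auto intro!: continuous_on_cnj continuous_on_szego[of _ _ "\<lambda>x. x", simplified])
  show "((\<lambda>p. g (torus_point p) * (szego w1 (fst p) * szego w2 (snd p)))
           has_integral g (w1, w2)) (cbox (0,0) (1,1))"
    by (rule key[OF cs(1,3), of "\<lambda>\<theta>. g (cis (2*pi*\<theta>), w2)"])
       (use w sub in \<open>auto intro: cauchy_on_unit_circle\<close>)
  show "((\<lambda>p. g (torus_point p) * (cnj (szego w1 (fst p)) * cnj (szego w2 (snd p))))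
           has_integral g (0, 0)) (cbox (0,0) (1,1))"
    by (rule key[OF cs(2,4), of "\<lambda>\<theta>. g (cis (2*pi*\<theta>), 0)"])
       (use w sub cauchy_on_unit_circle_cnj[of "\<lambda>u. g (u, 0)"] in \<open>auto intro: cauchy_on_unit_circle_cnj\<close>)
  show "((\<lambda>p. g (torus_point p) * (szego w1 (fst p) * cnj (szego w2 (snd p))))
           has_integral g (w1, 0)) (cbox (0,0) (1,1))"
    by (rule key[OF cs(1,4), of "\<lambda>\<theta>. g (cis (2*pi*\<theta>), 0)"])
       (use w sub cauchy_on_unit_circle[of "\<lambda>u. g (u, 0)"] in \<open>auto intro: cauchy_on_unit_circle_cnj\<close>)
  show "((\<lambda>p. g (torus_point p) * (cnj (szego w1 (fst p)) * szego w2 (snd p)))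
           has_integral g (0, w2)) (cbox (0,0) (1,1))"
    by (rule key[OF cs(2,3), of "\<lambda>\<theta>. g (cis (2*pi*\<theta>), w2)"])
       (use w sub cauchy_on_unit_circle_cnj[of "\<lambda>u. g (u, w2)"] in \<open>auto intro: cauchy_on_unit_circle\<close>)
qed

text \<open>
  The second formula expresses that the mixed Fourier coefficients vanish: its right-hand side is a
  function of w1 plus a function of w2, whereas a non-zero coefficient of mixed sign would give a
  mixed term.
\<close>

lemma torus_integrals_Re:
  assumes g: "bidisc_holomorphic R g" "R > 1" and w: "norm w1 < 1" "norm w2 < 1"
  shows "((\<lambda>p. 2 * of_real (Re (g (torus_point p))) * (szego w1 (fst p) * szego w2 (snd p)))
           has_integral g (w1, w2) + cnj (g (0, 0))) (cbox (0,0) (1,1))"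
    and "((\<lambda>p. 2 * of_real (Re (g (torus_point p))) * (szego w1 (fst p) * cnj (szego w2 (snd p))))
           has_integral g (w1, 0) + cnj (g (0, w2))) (cbox (0,0) (1,1))"
proof -
  have Re2: "2 * of_real (Re z) = z + cnj z" for z
    by (simp add: complex_add_cnj)
  note I = torus_integrals[OF g w]
  have C: "((\<lambda>x. cnj (h x)) has_integral cnj y) S" if "(h has_integral y) S" for h y and S :: "(real \<times> real) set"
    using has_integral_linear[OF that bounded_linear_cnj] by (simp add: o_def)
  show "((\<lambda>p. 2 * of_real (Re (g (torus_point p))) * (szego w1 (fst p) * szego w2 (snd p)))
           has_integral g (w1, w2) + cnj (g (0, 0))) (cbox (0,0) (1,1))"
    using has_integral_add[OF I(1) C[OF I(2)]] unfolding Re2 by (simp add: distrib_right)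
  show "((\<lambda>p. 2 * of_real (Re (g (torus_point p))) * (szego w1 (fst p) * cnj (szego w2 (snd p))))
           has_integral g (w1, 0) + cnj (g (0, w2))) (cbox (0,0) (1,1))"
    using has_integral_add[OF I(3) C[OF I(4)]] unfolding Re2 by (simp add: distrib_right)
qed

section \<open>A Peano curve\<close>

text \<open>
  The k-th digit is the difference of consecutive dyadic floors, so the partial sums telescope. The
  endpoint 1 needs the expansion with all digits 1.
\<close>

lemma binary_expansion:
  fixes x :: real assumes "0 \<le> x" "x \<le> 1"
  obtains a :: "nat \<Rightarrow> real" where "\<And>k. a k \<in> {0, 1}" "(\<lambda>k. a k / 2 ^ Suc k) sums x"
proof (cases "x = 1")
  case True
  show ?thesis
    by (rule that[of "\<lambda>_. 1"]) (use power_half_series in \<open>auto simp: True power_divide\<close>)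
next
  case False
  define d where "d k = \<lfloor>2 ^ k * x\<rfloor>" for k
  define a where "a k = real_of_int (d (Suc k) - 2 * d k)" for k
  have a: "a k \<in> {0, 1}" for k
  proof -
    have "d (Suc k) - 2 * d k = 0 \<or> d (Suc k) - 2 * d k = 1"
      unfolding d_def power_Suc by linarith
    then show ?thesis unfolding a_def by auto
  qed
  have "(\<Sum>k<n. a k / 2 ^ Suc k) = d n / 2 ^ n" for n
  proof (induction n)
    case 0
    have "d 0 = 0" using assms False by (simp add: d_def floor_eq_iff)
    then show ?case by simp
  next
    case (Suc n)
    then show ?case by (simp add: a_def field_simps)
  qed
  moreover have "(\<lambda>n. d n / 2 ^ n) \<longlonglongrightarrow> x"
  proof (rule real_tendsto_sandwich[where f="\<lambda>n. x - 1 / 2 ^ n" and h="\<lambda>n. x"])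
    have "2 ^ n * x - 1 \<le> d n \<and> d n \<le> 2 ^ n * x" for n unfolding d_def by linarith
    then have "(2 ^ n * x - 1) / 2 ^ n \<le> d n / 2 ^ n \<and> d n / 2 ^ n \<le> (2 ^ n * x) / 2 ^ n" for n
      by (intro conjI divide_right_mono) auto
    then have "x - 1 / 2 ^ n \<le> d n / 2 ^ n \<and> d n / 2 ^ n \<le> x" for n
      by (simp add: diff_divide_distrib)
    then show "\<forall>\<^sub>F n in sequentially. x - 1 / 2 ^ n \<le> d n / 2 ^ n"
       "\<forall>\<^sub>F n in sequentially. d n / 2 ^ n \<le> x"
      by auto
    show "(\<lambda>n. x - 1 / 2 ^ n) \<longlonglongrightarrow> x" by real_asymp
  qed auto
  ultimately have "(\<lambda>k. a k / 2 ^ Suc k) sums x" by (simp add: sums_def)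
  with a that show ?thesis by blast
qed

text \<open>
  Schoenberg's construction needs a continuous function of period 2 that is 0 on the first third of
  the unit interval and 1 on the last third. A clamped cosine has all these properties.
\<close>

definition schoenberg_step :: "real \<Rightarrow> real" where
  "schoenberg_step t = max 0 (min 1 (1/2 - cos (pi * t)))"

lemma schoenberg_step_periodic: "schoenberg_step (t + 2 * of_int m) = schoenberg_step t"
proof -
  have "cos (pi * (t + 2 * of_int m)) = cos (pi * t)"
  proof -
    have e: "pi * (t + 2 * of_int m) = pi * t + (2 * pi) * of_int m" by (simp add: algebra_simps)
    show ?thesis unfolding e cos_add cos_int_2pin sin_int_2pin by simp
  qed
  then show ?thesis by (simp add: schoenberg_step_def)
qed

lemma schoenberg_step_digit:
  assumes "b \<in> {0, 1}" "0 \<le> t" "t \<le> 1"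
  shows "schoenberg_step ((2 * b + t) / 3) = b"
proof (cases "b = 0")
  case True
  have "cos (pi / 3) \<le> cos (pi * (t / 3))" using assms by (intro cos_monotone_0_pi_le) auto
  then show ?thesis using True by (simp add: schoenberg_step_def cos_60)
next
  case False
  then have "b = 1" using assms by auto
  have "cos (pi * ((2+t) / 3)) \<le> cos (2 * pi / 3)"
    using assms by (intro cos_monotone_0_pi_le) (auto simp: field_simps)
  also have "cos (2 * pi / 3) = - (1/2)" using cos_120 by simp
  finally show ?thesis using \<open>b = 1\<close> by (simp add: schoenberg_step_def)
qed

definition cantor_point :: "(nat \<Rightarrow> real) \<Rightarrow> real" where
  "cantor_point b = (\<Sum>k. 2 * b k / 3 ^ Suc k)"

lemma cantor_point_sums:
  assumes "\<And>k. b k \<in> {0, 1}"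
  shows "(\<lambda>k. 2 * b k / 3 ^ Suc k) sums cantor_point b" "0 \<le> cantor_point b" "cantor_point b \<le> 1"
proof -
  have g: "(\<lambda>k. 2 / 3 * (1/3) ^ k) sums (2 / 3 * (1 / (1 - 1/3)) :: real)"
    by (intro sums_mult geometric_sums) auto
  have b: "0 \<le> b k" "b k \<le> 1" for k using assms[of k] by auto
  have le: "2 * b k / 3 ^ Suc k \<le> 2 / 3 * (1/3) ^ k" for k
    using b[of k] by (simp add: field_simps)
  have s: "summable (\<lambda>k. 2 * b k / 3 ^ Suc k)"
    by (rule summable_comparison_test'[OF sums_summable[OF g], of 0]) (use le b in auto)
  then show "(\<lambda>k. 2 * b k / 3 ^ Suc k) sums cantor_point b"
    unfolding cantor_point_def by (rule summable_sums)
  then show "cantor_point b \<le> 1" using sums_le[OF le _ g] by simp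
  show "0 \<le> cantor_point b" unfolding cantor_point_def by (rule suminf_nonneg[OF s]) (use b in auto)
qed

lemma cantor_point_shift:
  assumes "\<And>k. b k \<in> {0, 1}"
  shows "cantor_point b = (2 * b 0 + cantor_point (\<lambda>k. b (Suc k))) / 3"
proof -
  have "(\<lambda>k. 1 / 3 * (2 * b (Suc k) / 3 ^ Suc k)) sums (1 / 3 * cantor_point (\<lambda>k. b (Suc k)))"
    by (intro sums_mult cantor_point_sums assms)
  then have "(\<lambda>k. 2 * b (Suc k) / 3 ^ Suc (Suc k)) sums (1 / 3 * cantor_point (\<lambda>k. b (Suc k)))"
    by simp
  from sums_Suc[OF this] have "(\<lambda>k. 2 * b k / 3 ^ Suc k) sums (1 / 3 * cantor_point (\<lambda>k. b (Suc k)) + 2 * b 0 / 3)"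
    by simp
  then show ?thesis using sums_unique2[OF cantor_point_sums(1)[OF assms]] by fastforce
qed

text \<open>
  Multiplication by a power of 3 shifts the ternary expansion. The digits that leave it are all
  even, so they are absorbed by the period 2, and the leading digit of what remains decides in which
  third of the unit interval it lies.
\<close>

lemma schoenberg_step_cantor_point:
  assumes b: "\<And>k. b k \<in> {0, 1}"
  shows "schoenberg_step (3 ^ n * cantor_point b) = b n"
proof -
  \<comment> \<open>n shifts leave a Cantor point and split off an even integer\<close>
  have "\<exists>m::int. 3 ^ n * cantor_point b = cantor_point (\<lambda>k. b (k + n)) + 2 * real_of_int m"
  proof (induction n)
    case 0
    show ?case by (rule exI[of _ 0]) simp
  next
    case (Suc n)
    then obtain m :: int where m: "3 ^ n * cantor_point b = cantor_point (\<lambda>k. b (k + n)) + 2 * real_of_int m" by blast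
    obtain j :: int where j: "b n = of_int j" using b[of n] by (metis insertE of_int_0 of_int_1 singletonD)
    have "3 ^ Suc n * cantor_point b = 3 * (cantor_point (\<lambda>k. b (k + n)) + 2 * real_of_int m)" using m by simp
    also have "\<dots> = cantor_point (\<lambda>k. b (k + Suc n)) + 2 * of_int (j + 3 * m)"
      using cantor_point_shift[of "\<lambda>k. b (k + n)"] b j by simp
    finally show ?case by blast
  qed
  then obtain m :: int where "3 ^ n * cantor_point b = cantor_point (\<lambda>k. b (k + n)) + 2 * real_of_int m" by auto
  then have "schoenberg_step (3 ^ n * cantor_point b) = schoenberg_step (cantor_point (\<lambda>k. b (k + n)))"
    by (simp add: schoenberg_step_periodic)
  also have "\<dots> = b n"
    using b cantor_point_sums(2,3)[of "\<lambda>k. b (Suc (k + n))"]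
    by (subst cantor_point_shift) (auto intro: schoenberg_step_digit simp del: insert_iff)
  finally show ?thesis .
qed

lemma schoenberg_series_continuous:
  "continuous_on UNIV (\<lambda>t. \<Sum>k. schoenberg_step (3 ^ e k * t) / 2 ^ Suc k)"
proof (rule uniform_limit_theorem[OF _ Weierstrass_m_test])
  show "norm (schoenberg_step (3 ^ e k * t) / 2 ^ Suc k) \<le> (1/2) ^ Suc k" for k t
    by (auto simp: schoenberg_step_def field_simps)
  show "summable (\<lambda>k. (1 / 2) ^ Suc k :: real)" using power_half_series by (rule sums_summable)
  show "\<forall>\<^sub>F n in sequentially. continuous_on UNIV (\<lambda>x. \<Sum>k<n. schoenberg_step (3 ^ e k * x) / 2 ^ Suc k)"
    unfolding schoenberg_step_def by (intro always_eventually allI continuous_intros) auto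
qed auto

text \<open>
  Schoenberg's curve: a point of the Cantor set carries the binary digits of both coordinates, one
  at the even and one at the odd places.
\<close>

lemma peano_curve:
  obtains g :: "real \<Rightarrow> real \<times> real" where
    "continuous_on UNIV g" "cbox (0,0) (1,1) \<subseteq> g ` {0..1}"
proof -
  define G where "G e t = (\<Sum>k. schoenberg_step (3 ^ e k * t) / 2 ^ Suc k)" for e :: "nat \<Rightarrow> nat" and t
  define g where "g t = (G (\<lambda>k. 2 * k) t, G (\<lambda>k. 2 * k + 1) t)" for t
  have cont: "continuous_on UNIV g"
    unfolding g_def G_def by (intro continuous_on_Pair schoenberg_series_continuous)
  have onto: "(x, y) \<in> g ` {0..1}" if "0 \<le> x" "x \<le> 1" "0 \<le> y" "y \<le> 1" for x y
  proof -
    obtain a where a: "\<And>k. a k \<in> {0, 1}" "(\<lambda>k. a k / 2 ^ Suc k) sums x" using binary_expansion \<open>0 \<le> x\<close> \<open>x \<le> 1\<close> by blast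
    obtain c where c: "\<And>k. c k \<in> {0, 1}" "(\<lambda>k. c k / 2 ^ Suc k) sums y" using binary_expansion \<open>0 \<le> y\<close> \<open>y \<le> 1\<close> by blast
    define b where "b k = (if even k then a (k div 2) else c (k div 2))" for k
    have b: "b k \<in> {0, 1}" for k unfolding b_def using a(1) c(1) by auto
    have "g (cantor_point b) = (x, y)"
      using a(2) c(2) unfolding g_def G_def schoenberg_step_cantor_point[OF b]
      by (simp add: b_def sums_iff)
    moreover have "cantor_point b \<in> {0..1}" using cantor_point_sums(2,3)[OF b] by simp
    ultimately show ?thesis by (rule image_eqI[OF sym])
  qed
  have "cbox (0,0) (1,1) \<subseteq> g ` {0..1}"
  proof
    fix p :: "real \<times> real" assume "p \<in> cbox (0,0) (1,1)"
    then have "fst p \<in> cbox 0 1 \<and> snd p \<in> cbox 0 1"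
      using cbox_Pair_iff[of "fst p" "snd p" 0 0 1 1] by simp
    then show "p \<in> g ` {0..1}" using onto[of "fst p" "snd p"] by simp
  qed
  with cont show ?thesis by (rule that)
qed

section \<open>Weak compactness of measures on the unit square\<close>

text \<open>
  The least element s x of each fibre is a Borel choice, because the sublevel set of s at c is the
  image of the part of K up to c, which is compact.
\<close>

lemma borel_right_inverse:
  fixes g :: "real \<Rightarrow> 'a::t2_space"
  assumes g: "continuous_on K g" and K: "compact K"
  obtains s where "s \<in> borel_measurable (restrict_space borel (g ` K))"
    "\<And>x. x \<in> g ` K \<Longrightarrow> s x \<in> K \<and> g (s x) = x"
proof -
  define F where "F x = {t\<in>K. g t = x}" for x
  define s where "s x = Inf (F x)" for x
  have F: "compact (F x)" for x
  proof -
    have "closedin (top_of_set K) (K \<inter> g -` {x})" by (rule continuous_closedin_preimage[OF g]) auto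
    then have "compact (K \<inter> g -` {x})" using K closedin_compact by blast
    then show ?thesis unfolding F_def by (simp add: vimage_def Collect_conj_eq)
  qed
  have mem: "s x \<in> F x" if "x \<in> g ` K" for x
    unfolding s_def using that F[of x]
    by (intro closed_contains_Inf) (auto simp: compact_imp_closed compact_imp_bounded bounded_imp_bdd_below F_def)
  have "s \<in> borel_measurable (restrict_space borel (g ` K))"
  proof (rule borel_measurableI_le)
    fix c
    have "{x \<in> g ` K. s x \<le> c} = g ` (K \<inter> {..c})"
    proof (intro equalityI subsetI)
      fix x assume "x \<in> g ` (K \<inter> {..c})"
      then obtain t where t: "t \<in> K" "t \<le> c" "g t = x" by auto
      then have "s x \<le> t" unfolding s_def using F[of x]
        by (intro cInf_lower) (auto simp: F_def compact_imp_bounded bounded_imp_bdd_below)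
      then show "x \<in> {x \<in> g ` K. s x \<le> c}" using t by auto
    next
      fix x assume "x \<in> {x \<in> g ` K. s x \<le> c}"
      then have "s x \<in> K \<inter> {..c}" "g (s x) = x" using mem[of x] by (auto simp: F_def)
      then show "x \<in> g ` (K \<inter> {..c})" by (metis image_eqI)
    qed
    moreover have "compact (g ` (K \<inter> {..c}))"
      by (intro compact_continuous_image continuous_on_subset[OF g] compact_Int_closed K) auto
    moreover have "compact (g ` K)" using compact_continuous_image[OF g K] .
    ultimately show "{x \<in> space (restrict_space borel (g ` K)). s x \<le> c} \<in> sets (restrict_space borel (g ` K))"
      by (auto simp: space_restrict_space sets_restrict_space_iff borel_closed compact_imp_closed)
  qed
  then show ?thesis using that[of s] mem by (auto simp: F_def)
qed

text \<open>
  A Prokhorov theorem for the square, obtained from the one on the line. The Borel right inverse s of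
  the Peano curve g need not be continuous, but a test function h on the square is tested on the line
  as h \<circ> g, which is continuous, and h \<circ> g \<circ> s = h on the square.
\<close>

lemma helly_unit_square:
  fixes M :: "nat \<Rightarrow> (real \<times> real) measure"
  assumes prob: "\<And>n. prob_space (M n)" and sets: "\<And>n. sets (M n) = sets borel"
    and conc: "\<And>n. AE p in M n. p \<in> cbox (0,0) (1,1)"
  obtains r N where "strict_mono r" "prob_space N" "sets N = sets borel"
    "\<And>h :: real \<times> real \<Rightarrow> complex. continuous_on UNIV h \<Longrightarrow> bounded (range h) \<Longrightarrow>
       (\<lambda>n. integral\<^sup>L (M (r n)) h) \<longlonglongrightarrow> integral\<^sup>L N h"
proof -
  obtain g :: "real \<Rightarrow> real \<times> real" where g: "continuous_on UNIV g" "cbox (0,0) (1,1) \<subseteq> g ` {0..1}"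
    using peano_curve .
  obtain s where s: "s \<in> borel_measurable (restrict_space borel (g ` {0..1}))"
    "\<And>x. x \<in> g ` {0..1} \<Longrightarrow> s x \<in> {0..1} \<and> g (s x) = x"
    using borel_right_inverse[of "{0..1}" g] g(1) continuous_on_subset compact_Icc by blast
  define Q where "Q = g ` {0..1}"
  have Q[measurable]: "Q \<in> sets borel"
    unfolding Q_def using compact_continuous_image[OF continuous_on_subset[OF g(1)]]
    by (simp add: borel_compact)
  \<comment> \<open>s is extended by 0 to a Borel function on the whole plane\<close>
  define S where "S x = indicator Q x *\<^sub>R s x" for x
  have S[measurable]: "S \<in> borel_measurable borel"
    unfolding S_def using s(1) Q by (simp add: borel_measurable_restrict_space_iff Q_def)
  have [measurable]: "g \<in> borel_measurable borel" using g(1) by (rule borel_measurable_continuous_onI)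
  define L where "L n = distr (M n) borel S" for n
  note sets [measurable_cong]
  have L: "real_distribution (L n)" for n
    unfolding L_def using prob_space.real_distribution_distr[OF prob] S by simp
  have range_S: "S x \<in> {0..1}" for x using s(2)[of x] by (auto simp: S_def Q_def indicator_def)
  \<comment> \<open>all measures on the line live on the compact interval from 0 to 1\<close>
  have "tight L"
    unfolding tight_def
  proof (intro conjI allI impI L)
    fix e :: real assume "0 < e"
    have "1 - e < measure (L n) {-1<..1}" for n
    proof -
    have "measure (L n) {-1<..1} = measure (M n) (S -` {-1<..1} \<inter> space (M n))"
      unfolding L_def by (rule measure_distr) auto
    also have "S -` {-1<..1} \<inter> space (M n) = space (M n)" using range_S by force
    finally show ?thesis using \<open>0 < e\<close> prob_space.prob_space[OF prob] by simp
    qed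
    then show "\<exists>a b. a < b \<and> (\<forall>n. 1 - e < measure (L n) {a<..b})"
      by (intro exI[of _ "-1"] exI[of _ 1]) simp
  qed
  from tight_imp_convergent_subsubsequence[OF this strict_mono_id]
  obtain r N' where r: "strict_mono r" "real_distribution N'" "weak_conv_m (L \<circ> r) N'"
    by (auto simp: strict_mono_def)
  interpret N': real_distribution N' by fact
  define N where "N = distr N' borel g"
  show ?thesis
  proof (rule that[OF r(1)])
    show "prob_space N" unfolding N_def by (rule N'.prob_space_distr) simp
    show "sets N = sets borel" by (simp add: N_def)
    fix h :: "real \<times> real \<Rightarrow> complex" assume h: "continuous_on UNIV h" "bounded (range h)"
    have [measurable]: "h \<in> borel_measurable borel" using h(1) by (rule borel_measurable_continuous_onI)
    obtain B where B: "\<And>x. norm (h x) \<le> B" using h(2) by (auto simp: bounded_iff)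
    have "(\<lambda>n. integral\<^sup>L ((L \<circ> r) n) (\<lambda>t. h (g t))) \<longlonglongrightarrow> integral\<^sup>L N' (\<lambda>t. h (g t))"
    proof (rule weak_conv_imp_integral_bdd_continuous_conv[OF _ r(2,3) _ B])
      have "continuous_on UNIV (\<lambda>t. h (g t))" using continuous_on_compose2[OF h(1) g(1)] by simp
      then show "isCont (\<lambda>t. h (g t)) t" for t by (simp add: continuous_on_eq_continuous_at)
    qed (use L in simp)
    moreover have "integral\<^sup>L (L n) (\<lambda>t. h (g t)) = integral\<^sup>L (M n) h" for n
    proof -
      have "integral\<^sup>L (L n) (\<lambda>t. h (g t)) = integral\<^sup>L (M n) (\<lambda>x. h (g (S x)))"
        unfolding L_def by (rule integral_distr) auto
      also have "\<dots> = integral\<^sup>L (M n) h"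
      proof (rule integral_cong_AE)
        show "AE x in M n. h (g (S x)) = h x"
          using conc[of n]
        proof eventually_elim
          case (elim x)
          then have "x \<in> Q" using g(2) by (auto simp: Q_def)
          then show ?case using s(2)[of x] by (simp add: S_def Q_def)
        qed
      qed auto
      finally show ?thesis .
    qed
    moreover have "integral\<^sup>L N h = integral\<^sup>L N' (\<lambda>t. h (g t))"
      unfolding N_def by (rule integral_distr) auto
    ultimately show "(\<lambda>n. integral\<^sup>L (M (r n)) h) \<longlonglongrightarrow> integral\<^sup>L N h" by simp
  qed
qed

lemma integral_density_on_cbox:
  fixes h :: "real \<times> real \<Rightarrow> complex" and \<rho> :: "real \<times> real \<Rightarrow> real"
  assumes \<rho>: "continuous_on UNIV \<rho>" "\<And>p. p \<in> cbox a b \<Longrightarrow> 0 \<le> \<rho> p" and h: "continuous_on UNIV h"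
    and I: "((\<lambda>p. of_real (\<rho> p) * h p) has_integral y) (cbox a b)"
  shows "integral\<^sup>L (density lborel (\<lambda>p. ennreal (indicator (cbox a b) p * \<rho> p))) h = y"
proof -
  have [measurable]: "\<rho> \<in> borel_measurable borel" "h \<in> borel_measurable borel"
    using \<rho>(1) h by (auto intro: borel_measurable_continuous_onI)
  have c: "continuous_on (cbox a b) (\<lambda>p. of_real (\<rho> p) * h p)"
    by (intro continuous_intros continuous_on_subset[OF \<rho>(1)] continuous_on_subset[OF h]) auto
  have int: "integrable lborel (\<lambda>p. indicator (cbox a b) p *\<^sub>R (of_real (\<rho> p) * h p))"
    by (rule borel_integrable_compact[OF compact_cbox c])
  have "integral\<^sup>L (density lborel (\<lambda>p. ennreal (indicator (cbox a b) p * \<rho> p))) h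
     = (\<integral>p. (indicator (cbox a b) p * \<rho> p) *\<^sub>R h p \<partial>lborel)"
    by (rule integral_density) (auto simp: indicator_def \<rho>(2))
  also have "\<dots> = (\<integral>p. indicator (cbox a b) p *\<^sub>R (of_real (\<rho> p) * h p) \<partial>lborel)"
    by (intro Bochner_Integration.integral_cong) (auto simp: scaleR_conv_of_real)
  also have "\<dots> = y"
  proof (rule has_integral_unique)
    show "((\<lambda>p. indicator (cbox a b) p *\<^sub>R (of_real (\<rho> p) * h p)) has_integral
        (\<integral>p. indicator (cbox a b) p *\<^sub>R (of_real (\<rho> p) * h p) \<partial>lborel)) UNIV"
      by (rule has_integral_integral_lborel[OF int])
    have "((\<lambda>p. if p \<in> cbox a b then of_real (\<rho> p) * h p else 0) has_integral y) UNIV"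
      using I by (simp add: has_integral_restrict_UNIV)
    then show "((\<lambda>p. indicator (cbox a b) p *\<^sub>R (of_real (\<rho> p) * h p)) has_integral y) UNIV"
      by (rule has_integral_eq[rotated]) (auto simp: indicator_def)
  qed
  finally show ?thesis .
qed

text \<open>
  The limit is stated for test integrals whose values are known along the whole sequence, so that no
  subsequence appears. Densities of total mass 0 cannot be normalised and are treated separately: they
  vanish identically.
\<close>

lemma weak_limit_of_densities:
  fixes \<rho> :: "nat \<Rightarrow> real \<times> real \<Rightarrow> real"
  assumes cont: "\<And>n. continuous_on UNIV (\<rho> n)" and nonneg: "\<And>n p. 0 \<le> \<rho> n p"
    and mass: "\<And>n. (\<rho> n has_integral m) (cbox (0,0) (1,1))"
  obtains \<nu> where "finite_measure \<nu>" "sets \<nu> = sets borel"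
    "\<And>h Y y. \<lbrakk>continuous_on UNIV h; bounded (range h); Y \<longlonglongrightarrow> y;
       \<And>n. ((\<lambda>p. of_real (\<rho> n p) * h p) has_integral (Y n :: complex)) (cbox (0,0) (1,1))\<rbrakk> \<Longrightarrow>
       integral\<^sup>L \<nu> h = y"
proof (cases "m = 0")
  case True
  have zero: "\<rho> n p = 0" if "p \<in> cbox (0,0) (1,1)" for n p
  proof (rule has_integral_0_cbox_imp_0[of _ _ "\<rho> n"])
    show "continuous_on (cbox (0,0) (1,1)) (\<rho> n)" by (rule continuous_on_subset[OF cont]) simp
    show "(\<rho> n has_integral 0) (cbox (0,0) (1,1))" using mass[of n] True by simp
    have "((1/2, 1/2) :: real \<times> real) \<in> box (0,0) (1,1)" by (simp add: mem_box Basis_prod_def ball_Un)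
    then show "box (0,0) (1,1) \<noteq> ({} :: (real \<times> real) set)" by blast
  qed (use nonneg that in auto)
  show ?thesis
  proof (rule that[of "null_measure borel"])
    fix h and Y :: "nat \<Rightarrow> complex" and y
    assume Y: "Y \<longlonglongrightarrow> y" "\<And>n. ((\<lambda>p. of_real (\<rho> n p) * h p) has_integral Y n) (cbox (0,0) (1,1))"
    have "((\<lambda>p. of_real (\<rho> n p) * h p) has_integral 0) (cbox (0,0) (1,1))" for n
      by (rule has_integral_is_0) (simp add: zero)
    then have "Y n = 0" for n using Y(2) has_integral_unique by blast
    then have "Y = (\<lambda>_. 0)" by (simp add: fun_eq_iff)
    with Y(1) have "y = 0" by (simp add: LIMSEQ_const_iff)
    then show "integral\<^sup>L (null_measure borel) h = y" by simp
  qed (auto intro: finite_measureI)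
next
  case False
  have "0 \<le> m" using mass[of 0] nonneg by (rule has_integral_nonneg)
  with False have m: "m > 0" by simp
  define M where "M n = density lborel (\<lambda>p. ennreal (indicator (cbox (0,0) (1,1)) p * (\<rho> n p / m)))" for n
  have [measurable]: "\<rho> n \<in> borel_measurable borel" for n
    using cont by (rule borel_measurable_continuous_onI)
  have "emeasure (M n) UNIV = 1" for n
  proof -
    have c: "continuous_on (cbox (0,0) (1,1)) (\<lambda>p. \<rho> n p / m)"
      using m by (intro continuous_intros continuous_on_subset[OF cont]) auto
    have i: "integrable lborel (\<lambda>p. indicator (cbox (0,0) (1,1)) p *\<^sub>R (\<rho> n p / m))"
      by (rule borel_integrable_compact[OF compact_cbox c])
    have "((\<lambda>p. \<rho> n p / m) has_integral m / m) (cbox (0,0) (1,1))"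
      by (rule has_integral_divide[OF mass])
    then have "((\<lambda>p. if p \<in> cbox (0,0) (1,1) then \<rho> n p / m else 0) has_integral 1) UNIV"
      using m by (simp add: has_integral_restrict_UNIV)
    then have "((\<lambda>p. indicator (cbox (0,0) (1,1)) p *\<^sub>R (\<rho> n p / m)) has_integral 1) UNIV"
      by (rule has_integral_eq[rotated]) (auto simp: indicator_def)
    then have "(\<integral>p. indicator (cbox (0,0) (1,1)) p *\<^sub>R (\<rho> n p / m) \<partial>lborel) = 1"
      using has_integral_integral_lborel[OF i] has_integral_unique by blast
    then have "(\<integral>\<^sup>+p. ennreal (indicator (cbox (0,0) (1,1)) p *\<^sub>R (\<rho> n p / m)) \<partial>lborel) = ennreal 1"
      using i nonneg m by (subst nn_integral_eq_integral) auto
    then show ?thesis unfolding M_def by (subst emeasure_density) auto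
  qed
  then have prob: "prob_space (M n)" for n
    by (intro prob_spaceI) (simp add: M_def)
  have sets: "sets (M n) = sets borel" for n by (simp add: M_def)
  have conc: "AE p in M n. p \<in> cbox (0,0) (1,1)" for n
    unfolding M_def by (subst AE_density) (auto simp: indicator_def)
  obtain r N where r: "strict_mono r" and N: "prob_space N" "sets N = sets borel"
    and lim: "\<And>h :: real \<times> real \<Rightarrow> complex. continuous_on UNIV h \<Longrightarrow> bounded (range h) \<Longrightarrow>
       (\<lambda>n. integral\<^sup>L (M (r n)) h) \<longlonglongrightarrow> integral\<^sup>L N h"
    by (rule helly_unit_square[of M, OF prob sets conc]) blast
  interpret N: prob_space N by fact
  note N(2) [measurable_cong]
  define \<nu> where "\<nu> = density N (\<lambda>_. ennreal m)"
  show ?thesis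
  proof (rule that[of \<nu>])
    show "finite_measure \<nu>"
      by (rule finite_measureI) (simp add: \<nu>_def emeasure_density N.emeasure_space_1)
    show "sets \<nu> = sets borel" by (simp add: \<nu>_def N)
    fix h and Y :: "nat \<Rightarrow> complex" and y
    assume h: "continuous_on UNIV h" "bounded (range h)"
      and Y: "Y \<longlonglongrightarrow> y" "\<And>n. ((\<lambda>p. of_real (\<rho> n p) * h p) has_integral Y n) (cbox (0,0) (1,1))"
    have [measurable]: "h \<in> borel_measurable N"
      using borel_measurable_continuous_onI[OF h(1)] N(2) by (simp cong: measurable_cong_sets)
    have "integral\<^sup>L (M n) h = Y n / m" for n
      unfolding M_def
    proof (rule integral_density_on_cbox)
      show "continuous_on UNIV (\<lambda>p. \<rho> n p / m)" using m by (intro continuous_intros cont) auto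
      show "((\<lambda>p. of_real (\<rho> n p / m) * h p) has_integral Y n / m) (cbox (0,0) (1,1))"
        using has_integral_divide[OF Y(2)[of n], of "of_real m"] by simp
    qed (use h nonneg m in auto)
    then have "(\<lambda>n. Y (r n) / m) \<longlonglongrightarrow> integral\<^sup>L N h" using lim[OF h] by simp
    moreover have "(\<lambda>n. Y (r n) / m) \<longlonglongrightarrow> y / m"
      using m by (intro tendsto_intros LIMSEQ_subseq_LIMSEQ[OF Y(1) r, unfolded o_def]) auto
    ultimately have "integral\<^sup>L N h = y / m" by (rule LIMSEQ_unique)
    moreover have "integral\<^sup>L \<nu> h = m *\<^sub>R integral\<^sup>L N h"
      unfolding \<nu>_def using m by (subst integral_density) auto
    ultimately show "integral\<^sup>L \<nu> h = y" using m by (simp add: scaleR_conv_of_real)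
  qed
qed

section \<open>The Herglotz representation on the bidisc\<close>

lemma szego_products_continuous_bounded:
  assumes "norm w1 < 1" "norm w2 < 1"
  shows "continuous_on UNIV (\<lambda>p::real \<times> real. szego w1 (fst p) * szego w2 (snd p))"
    and "continuous_on UNIV (\<lambda>p::real \<times> real. szego w1 (fst p) * cnj (szego w2 (snd p)))"
    and "bounded (range (\<lambda>p::real \<times> real. szego w1 (fst p) * szego w2 (snd p)))"
    and "bounded (range (\<lambda>p::real \<times> real. szego w1 (fst p) * cnj (szego w2 (snd p))))"
proof -
  show "continuous_on UNIV (\<lambda>p::real \<times> real. szego w1 (fst p) * szego w2 (snd p))"
    "continuous_on UNIV (\<lambda>p::real \<times> real. szego w1 (fst p) * cnj (szego w2 (snd p)))"
    by (intro continuous_intros continuous_on_szego assms)+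
  have "norm (szego w1 x) * norm (szego w2 y) \<le> 1 / (1 - norm w1) * (1 / (1 - norm w2))" for x y
    using assms by (intro mult_mono norm_szego_le) auto
  then show "bounded (range (\<lambda>p::real \<times> real. szego w1 (fst p) * szego w2 (snd p)))"
    "bounded (range (\<lambda>p::real \<times> real. szego w1 (fst p) * cnj (szego w2 (snd p))))"
    by (auto simp: bounded_iff norm_mult simp del: times_divide_eq_left times_divide_eq_right)
qed

lemma bidisc_holomorphic_dilate:
  assumes f: "bidisc_holomorphic 1 f" and r: "0 < r" "r < 1"
  shows "bidisc_holomorphic (1 / r) (\<lambda>w. f (of_real r * fst w, of_real r * snd w))"
proof -
  have "of_real r * z \<in> ball 0 1" if "z \<in> ball 0 (1 / r)" for z :: complex
    using that r by (simp add: norm_mult field_simps)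
  note m = this
  have "continuous_on (ball 0 (1 / r) \<times> ball 0 (1 / r)) (\<lambda>w. f (of_real r * fst w, of_real r * snd w))"
  proof (rule continuous_on_compose2[where g=f and t="ball 0 1 \<times> ball 0 1"])
    show "continuous_on (ball 0 1 \<times> ball 0 1) f" using f by (simp add: bidisc_holomorphic_def)
    show "continuous_on (ball 0 (1 / r) \<times> ball 0 (1 / r)) (\<lambda>w::complex\<times>complex. (of_real r * fst w, of_real r * snd w))"
      by (intro continuous_intros)
    show "(\<lambda>w::complex\<times>complex. (of_real r * fst w, of_real r * snd w)) ` (ball 0 (1 / r) \<times> ball 0 (1 / r)) \<subseteq> ball 0 1 \<times> ball (0::complex) (1::real)"
    proof (rule image_subsetI)
      fix w :: "complex \<times> complex" assume "w \<in> ball 0 (1 / r) \<times> ball 0 (1 / r)"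
      then have "fst w \<in> ball 0 (1 / r)" "snd w \<in> ball 0 (1 / r)" by (auto simp only: mem_Times_iff)
      then show "(of_real r * fst w, of_real r * snd w) \<in> ball 0 1 \<times> ball (0::complex) (1::real)"
        using m by (simp only: mem_Times_iff fst_conv snd_conv)
    qed
  qed
  moreover have "(\<lambda>u. f (of_real r * u, of_real r * w)) holomorphic_on ball 0 (1/r)"
      "(\<lambda>u. f (of_real r * w, of_real r * u)) holomorphic_on ball 0 (1/r)" if "w \<in> ball 0 (1/r)" for w
  proof -
    have h: "(\<lambda>u. f (u, of_real r * w)) holomorphic_on ball 0 1" "(\<lambda>u. f (of_real r * w, u)) holomorphic_on ball 0 1"
      using f m[OF that] by (auto simp: bidisc_holomorphic_def)
    have l: "(\<lambda>u. of_real r * u) holomorphic_on ball 0 (1/r)" by (intro holomorphic_intros)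
    have i: "(\<lambda>u. of_real r * u) ` ball 0 (1/r) \<subseteq> ball (0::complex) 1" using m by blast
    show "(\<lambda>u. f (of_real r * u, of_real r * w)) holomorphic_on ball 0 (1/r)"
      "(\<lambda>u. f (of_real r * w, of_real r * u)) holomorphic_on ball 0 (1/r)"
      using holomorphic_on_compose_gen[OF l h(1) i] holomorphic_on_compose_gen[OF l h(2) i]
      by (simp_all add: o_def)
  qed
  ultimately show ?thesis by (simp add: bidisc_holomorphic_def)
qed

text \<open>
  The torus integrals of the dilates of f pass to the limit, since the kernels are continuous and
  bounded on the torus for fixed w1 and w2.
\<close>

lemma herglotz_bidisc:
  assumes f: "bidisc_holomorphic 1 f" and pos: "\<And>w1 w2. norm w1 < 1 \<Longrightarrow> norm w2 < 1 \<Longrightarrow> Re (f (w1, w2)) \<ge> 0"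
  obtains \<nu> :: "(real \<times> real) measure" where "finite_measure \<nu>" "sets \<nu> = sets borel"
    "\<And>w1 w2. norm w1 < 1 \<Longrightarrow> norm w2 < 1 \<Longrightarrow>
       (\<integral>p. szego w1 (fst p) * szego w2 (snd p) \<partial>\<nu>) = (f (w1, w2) + cnj (f (0, 0))) / 2"
    "\<And>w1 w2. norm w1 < 1 \<Longrightarrow> norm w2 < 1 \<Longrightarrow>
       (\<integral>p. szego w1 (fst p) * cnj (szego w2 (snd p)) \<partial>\<nu>) = (f (w1, 0) + cnj (f (0, w2))) / 2"
proof -
  define r :: "nat \<Rightarrow> real" where "r n = (n + 1) / (n + 2)" for n
  have r: "0 < r n" "r n < 1" for n by (auto simp: r_def)
  have r_lim: "r \<longlonglongrightarrow> 1" unfolding r_def by real_asymp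
  \<comment> \<open>the dilates are holomorphic beyond the closed bidisc, so the torus integrals apply to them\<close>
  define F where "F n w = f (of_real (r n) * fst w, of_real (r n) * snd w)" for n w
  have F: "bidisc_holomorphic (1 / r n) (F n)" "1 < 1 / r n" for n
    unfolding F_def using bidisc_holomorphic_dilate[OF f r] r[of n] by (auto simp: field_simps)
  have F_lim: "(\<lambda>n. F n (w1, w2)) \<longlonglongrightarrow> f (w1, w2)" if "norm w1 < 1" "norm w2 < 1" for w1 w2
  proof -
    have "continuous_on (ball 0 1 \<times> ball 0 1) f" "(w1, w2) \<in> ball 0 1 \<times> ball 0 1"
      using f that by (auto simp: bidisc_holomorphic_def)
    moreover have "(\<lambda>n. (of_real (r n) * w1, of_real (r n) * w2)) \<longlonglongrightarrow> (of_real 1 * w1, of_real 1 * w2)"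
      by (intro tendsto_intros r_lim)
    moreover have "(of_real (r n) * w1, of_real (r n) * w2) \<in> ball 0 1 \<times> ball 0 1" for n
      using that r[of n] mult_strict_mono[of "r n" 1 "norm w1" 1] mult_strict_mono[of "r n" 1 "norm w2" 1]
      by (simp add: norm_mult)
    ultimately have "(\<lambda>n. f (of_real (r n) * w1, of_real (r n) * w2)) \<longlonglongrightarrow> f (w1, w2)"
      by (intro continuous_on_tendsto_compose[of "ball 0 1 \<times> ball 0 1" f]) auto
    then show ?thesis unfolding F_def by simp
  qed
  define \<rho> where "\<rho> n p = Re (F n (torus_point p))" for n p
  note I = torus_integrals_Re[OF F, folded \<rho>_def]
  have c: "continuous_on UNIV (\<rho> n)" for n
  proof -
    have "continuous_on UNIV (\<lambda>p. F n (torus_point p))"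
    proof (rule continuous_on_compose2[where g="F n" and t="ball 0 (1 / r n) \<times> ball 0 (1 / r n)"])
      show "continuous_on UNIV torus_point"
        unfolding torus_point_def by (intro continuous_intros)
    qed (use F[of n] in \<open>auto simp: bidisc_holomorphic_def torus_point_def\<close>)
    then show ?thesis unfolding \<rho>_def by (intro continuous_intros)
  qed
  have nn: "0 \<le> \<rho> n p" for n p
    unfolding \<rho>_def F_def torus_point_def using r[of n] by (auto intro!: pos simp: norm_mult)
  have mass: "(\<rho> n has_integral Re (f (0, 0))) (cbox (0,0) (1,1))" for n
  proof -
    have "((\<lambda>p. 2 * of_real (\<rho> n p) :: complex) has_integral (F n (0,0) + cnj (F n (0,0)))) (cbox (0,0) (1,1))"
      using I(1)[of 0 0 n] by simp
    then have "((\<lambda>p. Re (2 * of_real (\<rho> n p))) has_integral Re (F n (0,0) + cnj (F n (0,0)))) (cbox (0,0) (1,1))"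
      by (rule has_integral_Re)
    then have "((\<lambda>p. 2 * \<rho> n p / 2) has_integral 2 * Re (f (0,0)) / 2) (cbox (0,0) (1,1))"
      by (intro has_integral_divide) (simp add: F_def)
    then show ?thesis by simp
  qed
  obtain \<nu> where \<nu>: "finite_measure \<nu>" "sets \<nu> = sets borel" and lim:
    "\<And>h Y y. \<lbrakk>continuous_on UNIV h; bounded (range h); Y \<longlonglongrightarrow> y;
       \<And>n. ((\<lambda>p. of_real (\<rho> n p) * h p) has_integral (Y n :: complex)) (cbox (0,0) (1,1))\<rbrakk> \<Longrightarrow>
       integral\<^sup>L \<nu> h = y"
    by (rule weak_limit_of_densities[of \<rho>, OF c nn mass]) blast
  have half: "((\<lambda>p. of_real (\<rho> n p) * h p) has_integral y / 2) (cbox (0,0) (1,1))"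
    if "((\<lambda>p. 2 * of_real (\<rho> n p) * h p) has_integral y) (cbox (0,0) (1,1))" for n y and h :: "_ \<Rightarrow> complex"
    using has_integral_divide[OF that, of 2] by simp
  show ?thesis
  proof (rule that[OF \<nu>])
    fix w1 w2 :: complex assume w: "norm w1 < 1" "norm w2 < 1"
    show "(\<integral>p. szego w1 (fst p) * szego w2 (snd p) \<partial>\<nu>) = (f (w1, w2) + cnj (f (0, 0))) / 2"
      by (rule lim[OF szego_products_continuous_bounded(1,3)[OF w] _ half[OF I(1)[OF w]]])
         (intro tendsto_intros F_lim w; simp)
    show "(\<integral>p. szego w1 (fst p) * cnj (szego w2 (snd p)) \<partial>\<nu>) = (f (w1, 0) + cnj (f (0, w2))) / 2"
      by (rule lim[OF szego_products_continuous_bounded(2,4)[OF w] _ half[OF I(2)[OF w]]])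
         (intro tendsto_intros F_lim w; simp)
  qed
qed

text \<open>
  A mixed second difference annihilates every sum of a function of w1 and a function of w2, and the
  kernel with w = 0 is the constant 1.
\<close>

lemma mixed_moments_vanish:
  assumes \<nu>: "finite_measure \<nu>" "sets \<nu> = sets borel"
    and I: "\<And>w1 w2. norm w1 < 1 \<Longrightarrow> norm w2 < 1 \<Longrightarrow>
       (\<integral>p. szego w1 (fst p) * cnj (szego w2 (snd p)) \<partial>\<nu>) = F w1 + G w2"
    and w: "norm w1 < 1" "norm w2 < 1"
  shows "(\<integral>p. (szego w1 (fst p) - 1) * cnj (szego w2 (snd p) - 1) \<partial>\<nu>) = 0"
proof -
  interpret finite_measure \<nu> by fact
  have int: "integrable \<nu> (\<lambda>p. szego a (fst p) * cnj (szego b (snd p)))" if ab: "norm a < 1" "norm b < 1" for a b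
  proof -
    obtain B where "\<And>p. norm (szego a (fst p) * cnj (szego b (snd p))) \<le> B" for p :: "real \<times> real"
      using szego_products_continuous_bounded(4)[OF ab] by (auto simp: bounded_iff)
    moreover have "(\<lambda>p. szego a (fst p) * cnj (szego b (snd p))) \<in> borel_measurable \<nu>"
      using borel_measurable_continuous_onI[OF szego_products_continuous_bounded(2)[OF ab]] \<nu>(2)
      by (simp cong: measurable_cong_sets)
    ultimately show ?thesis by (intro integrable_const_bound[of _ B]) auto
  qed
  have e: "(szego w1 (fst p) - 1) * cnj (szego w2 (snd p) - 1) =
     (szego w1 (fst p) * cnj (szego w2 (snd p)) - szego w1 (fst p) * cnj (szego 0 (snd p)))
     - (szego 0 (fst p) * cnj (szego w2 (snd p)) - szego 0 (fst p) * cnj (szego 0 (snd p)))" for p :: "real \<times> real"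
    by (simp add: algebra_simps)
  have z: "norm (0::complex) < 1" by simp
  note J = int[OF w] int[OF w(1) z] int[OF z w(2)] int[OF z z]
  show ?thesis unfolding e
    by (subst Bochner_Integration.integral_diff; (intro Bochner_Integration.integrable_diff J)?)+
       (use I[OF w] I[OF w(1) z] I[OF z w(2)] I[OF z z] in simp)
qed

section \<open>Mass on the faces of the torus\<close>

text \<open>
  For x \<rightarrow> 1 from below, the function (1 - x) (1 / (1 - x cnj \<zeta>) - 1) is bounded by 2 and converges
  pointwise to the indicator of \<zeta> = 1, so dominated convergence turns the vanishing of the integrals
  into the vanishing of the part at \<zeta> = 1.
\<close>

lemma radial_limit_atom:
  fixes h :: "'a \<Rightarrow> complex"
  assumes h: "integrable M h" and u: "u \<in> borel_measurable M"
    and zero: "\<And>x::real. 0 < x \<Longrightarrow> x < 1 \<Longrightarrow> (\<integral>p. (szego (of_real x) (u p) - 1) * h p \<partial>M) = 0"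
  shows "(\<integral>p. of_bool (cis (2 * pi * u p) = 1) * h p \<partial>M) = 0"
proof -
  define x :: "nat \<Rightarrow> real" where "x n = (n + 1) / (n + 2)" for n
  have x: "0 < x n" "x n < 1" for n by (auto simp: x_def)
  have x_lim: "x \<longlonglongrightarrow> 1" unfolding x_def by real_asymp
  define k where "k n p = of_real (1 - x n) * ((szego (of_real (x n)) (u p) - 1) * h p)" for n p
  note u[measurable]
  have [measurable]: "h \<in> borel_measurable M" using h by auto
  have pt: "(\<lambda>n. k n p) \<longlonglongrightarrow> of_bool (cis (2 * pi * u p) = 1) * h p" for p
  proof (cases "cis (2 * pi * u p) = 1")
    case True
    then have c: "cis (- (2 * pi * u p)) = 1" by (simp only: cis_cnj[symmetric] complex_cnj_one)
    have "k n p = of_real (x n) * h p" for n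
    proof -
      have "of_real (1 - x n) * (szego (of_real (x n)) (u p) - 1) = of_real (x n)"
      proof -
        have "1 - of_real (x n) \<noteq> (0::complex)" using x(2)[of n] by (metis of_real_diff of_real_eq_0_iff of_real_1 right_minus_eq less_irrefl)
        then show ?thesis unfolding szego_def c by (simp add: right_diff_distrib)
      qed
      then show ?thesis unfolding k_def mult.assoc[symmetric] by simp
    qed
    moreover have "(\<lambda>n. of_real (x n) * h p) \<longlonglongrightarrow> of_real 1 * h p" by (intro tendsto_intros x_lim)
    ultimately show ?thesis using True by simp
  next
    case False
    then have c: "1 - cis (- (2 * pi * u p)) \<noteq> 0"
      by (simp only: cis_cnj[symmetric] right_minus_eq eq_commute[of 1] complex_cnj_one_iff not_False_eq_True)
    have "(\<lambda>n. k n p) \<longlonglongrightarrow> of_real (1 - 1) * ((1 / (1 - of_real 1 * cis (- (2 * pi * u p))) - 1) * h p)"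
      unfolding k_def szego_def using c by (intro tendsto_intros x_lim) simp
    then show ?thesis using False by simp
  qed
  have bound: "norm (k n p) \<le> 2 * norm (h p)" for n p
  proof -
    have "norm (of_real (1 - x n) * (szego (of_real (x n)) (u p) - 1))
        = (1 - x n) * norm (szego (of_real (x n)) (u p) - 1)"
      unfolding norm_mult norm_of_real using x(2)[of n] by simp
    also have "\<dots> \<le> (1 - x n) * (norm (szego (of_real (x n)) (u p)) + norm (1::complex))"
      using x(2)[of n] by (intro mult_left_mono norm_triangle_ineq4) auto
    also have "\<dots> = (1 - x n) * norm (szego (of_real (x n)) (u p)) + (1 - x n) * 1"
      by (simp only: norm_one distrib_left)
    also have "\<dots> \<le> (1 - x n) * (1 / (1 - norm (of_real (x n) :: complex))) + (1 - x n) * 1"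
      using x[of n] by (intro add_right_mono mult_left_mono norm_szego_le) auto
    also have "\<dots> \<le> 2" using x[of n] by simp
    finally have "norm (of_real (1 - x n) * (szego (of_real (x n)) (u p) - 1)) * norm (h p) \<le> 2 * norm (h p)"
      by (intro mult_right_mono) auto
    then show ?thesis by (simp add: k_def norm_mult mult.assoc)
  qed
  have "(\<lambda>n. integral\<^sup>L M (k n)) \<longlonglongrightarrow> (\<integral>p. of_bool (cis (2 * pi * u p) = 1) * h p \<partial>M)"
  proof (rule integral_dominated_convergence[where w="\<lambda>p. 2 * norm (h p)"])
    show "k n \<in> borel_measurable M" for n unfolding k_def by measurable
    show "(\<lambda>p. of_bool (cis (2 * pi * u p) = 1) * h p) \<in> borel_measurable M"
      using pt by (rule borel_measurable_LIMSEQ_metric[rotated]) (unfold k_def, measurable)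
    show "integrable M (\<lambda>p. 2 * norm (h p))" using h by simp
  qed (use pt bound in auto)
  moreover have "integral\<^sup>L M (k n) = 0" for n
    unfolding k_def using zero[OF x] by simp
  ultimately show ?thesis by (simp add: LIMSEQ_const_iff)
qed

lemma integrable_szego:
  assumes "finite_measure M" "u \<in> borel_measurable M" "norm w < 1"
  shows "integrable M (\<lambda>p. szego w (u p))"
proof -
  interpret finite_measure M by fact
  note assms(2)[measurable]
  show ?thesis by (rule integrable_const_bound[of _ "1 / (1 - norm w)"]) (auto intro: norm_szego_le assms)
qed

text \<open>
  The first claim is the radial limit in the first variable. It says that the mass on the face has no
  Fourier coefficients except the mean, as for Lebesgue measure; the second claim, that this mass has no
  atom at the corner, is the radial limit in the second variable.
\<close>

lemma face_mass_is_uniform: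
  assumes M: "finite_measure M" and u: "u \<in> borel_measurable M" and v: "v \<in> borel_measurable M"
    and mixed: "\<And>w1 w2. norm w1 < 1 \<Longrightarrow> norm w2 < 1 \<Longrightarrow>
        (\<integral>p. (szego w1 (u p) - 1) * cnj (szego w2 (v p) - 1) \<partial>M) = 0"
  shows "norm w < 1 \<Longrightarrow> (\<integral>p. of_bool (cis (2 * pi * u p) = 1) * (szego w (v p) - 1) \<partial>M) = 0"
    and "AE p in M. \<not> (cis (2 * pi * u p) = 1 \<and> cis (2 * pi * v p) = 1)"
proof -
  interpret finite_measure M by fact
  note u[measurable] v[measurable]
  have mes: "Measurable.pred M (\<lambda>p. cis (2 * pi * u p) = 1)" "Measurable.pred M (\<lambda>p. cis (2 * pi * v p) = 1)"
    unfolding complex_eq_iff cis.sel one_complex.sel by measurable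
  note mes[measurable]
  show *: "(\<integral>p. of_bool (cis (2 * pi * u p) = 1) * (szego w (v p) - 1) \<partial>M) = 0" if w: "norm w < 1" for w
  proof -
    have "(\<integral>p. of_bool (cis (2 * pi * u p) = 1) * cnj (szego w (v p) - 1) \<partial>M) = 0"
    proof (rule radial_limit_atom[OF _ u])
      show "integrable M (\<lambda>p. cnj (szego w (v p) - 1))"
        using integrable_szego[OF M v w] by (intro integrable_cnj) simp
    qed (use mixed w in auto)
    moreover have "cnj (of_bool b) = of_bool b" for b by (cases b) simp_all
    ultimately have "cnj (\<integral>p. cnj (of_bool (cis (2 * pi * u p) = 1) * (szego w (v p) - 1)) \<partial>M) = 0"
      by simp
    then have "cnj (cnj (\<integral>p. of_bool (cis (2 * pi * u p) = 1) * (szego w (v p) - 1) \<partial>M)) = 0"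
      by (simp only: Bochner_Integration.integral_cnj)
    then show ?thesis by simp
  qed
  have "(\<integral>p. of_bool (cis (2 * pi * v p) = 1) * of_bool (cis (2 * pi * u p) = 1) \<partial>M) = (0 :: complex)"
  proof (rule radial_limit_atom[OF _ v])
    show "integrable M (\<lambda>p. of_bool (cis (2 * pi * u p) = 1) :: complex)"
      by (rule integrable_const_bound[of _ 1]) auto
    fix x :: real assume "0 < x" "x < 1"
    then show "(\<integral>p. (szego (of_real x) (v p) - 1) * of_bool (cis (2 * pi * u p) = 1) \<partial>M) = 0"
      using *[of "of_real x"] by (simp add: mult.commute)
  qed
  also have "(\<lambda>p. of_bool (cis (2 * pi * v p) = 1) * of_bool (cis (2 * pi * u p) = 1) :: complex)
    = (\<lambda>p. of_real (indicator {p. cis (2 * pi * u p) = 1 \<and> cis (2 * pi * v p) = 1} p))"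
    by (auto simp: indicator_def fun_eq_iff)
  finally have "(\<integral>p. indicator {p. cis (2 * pi * u p) = 1 \<and> cis (2 * pi * v p) = 1} p \<partial>M) = (0::real)"
    by simp
  then have "measure M ({p. cis (2 * pi * u p) = 1 \<and> cis (2 * pi * v p) = 1} \<inter> space M) = 0"
    by (simp add: measure_def)
  then have "emeasure M {p\<in>space M. cis (2 * pi * u p) = 1 \<and> cis (2 * pi * v p) = 1} = 0"
    by (simp add: emeasure_eq_measure Int_def conj_commute)
  then show "AE p in M. \<not> (cis (2 * pi * u p) = 1 \<and> cis (2 * pi * v p) = 1)"
    by (subst AE_iff_measurable[OF _ refl]) auto
qed

section \<open>The Cayley transform\<close>

definition cayley :: "complex \<Rightarrow> complex" where
  "cayley z = (z - \<i>) / (z + \<i>)"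

definition inverse_cayley :: "complex \<Rightarrow> complex" where
  "inverse_cayley w = \<i> * (1 + w) / (1 - w)"

lemma norm_cayley_less_1: assumes "Im z > 0" shows "norm (cayley z) < 1"
proof -
  have "(norm (z - \<i>))\<^sup>2 < (norm (z + \<i>))\<^sup>2"
    using assms unfolding cmod_power2 by (simp add: power2_eq_square algebra_simps)
  then have "norm (z - \<i>) < norm (z + \<i>)" by (rule power2_less_imp_less) simp
  then show ?thesis unfolding cayley_def norm_divide by (subst divide_less_eq_1) auto
qed

lemma inverse_cayley_cayley: assumes "Im z > 0" shows "inverse_cayley (cayley z) = z"
proof -
  have nz: "z + \<i> \<noteq> 0" using assms by (auto simp: complex_eq_iff)
  have "1 + cayley z = 2 * z / (z + \<i>)" "1 - cayley z = 2 * \<i> / (z + \<i>)"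
    using nz by (simp_all add: cayley_def field_simps)
  then show ?thesis using nz by (simp add: inverse_cayley_def)
qed

lemma Im_inverse_cayley: assumes "norm w < 1" shows "Im (inverse_cayley w) > 0"
proof -
  have "w \<noteq> 1" using assms by auto
  have "inverse_cayley w = (\<i> * ((1 + w) * cnj (1 - w))) / of_real ((norm (1 - w))\<^sup>2)"
    unfolding inverse_cayley_def by (subst complex_div_cnj) (simp only: mult.assoc of_real_power)
  then have "Im (inverse_cayley w) = Re ((1 + w) * cnj (1 - w)) / (norm (1 - w))\<^sup>2"
    by (simp only: Im_divide_of_real) simp
  also have "Re ((1 + w) * cnj (1 - w)) = 1 - (norm w)\<^sup>2"
    unfolding cmod_power2 by (simp add: power2_eq_square algebra_simps)
  also have "\<dots> / (norm (1 - w))\<^sup>2 > 0"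
    using assms \<open>w \<noteq> 1\<close> by (simp add: power_less_one_iff abs_square_less_1)
  finally show ?thesis .
qed

text \<open>
  This is - cot (\<pi> \<theta>), the real boundary point that corresponds to the angle \<theta>. At \<zeta> = 1, which
  corresponds to the point at infinity, division by zero makes it 0.
\<close>

definition boundary_point :: "real \<Rightarrow> real" where
  "boundary_point \<theta> = Re (inverse_cayley (cis (2 * pi * \<theta>)))"

text \<open>
  Everything is expressed by t through \<zeta> = (t - i) / (t + i); then both identities compare explicit
  fractions in t and z.
\<close>

lemma boundary_point_identities:
  assumes ne: "cis (2 * pi * \<theta>) \<noteq> 1" and z: "Im z > 0"
  defines "t \<equiv> boundary_point \<theta>"
  shows "1 / (of_real t - z) - 1 / (of_real t + \<i>) = 2 * \<i> * szego (cayley z) \<theta> / of_real (1 + t\<^sup>2)"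
    and "1 / (of_real t - z) - 1 / (of_real t - \<i>) = 2 * \<i> * (szego (cayley z) \<theta> - 1) / of_real (1 + t\<^sup>2)"
proof -
  define \<zeta> where "\<zeta> = cis (2 * pi * \<theta>)"
  have \<zeta>: "\<zeta> \<noteq> 1" "\<zeta> \<noteq> 0" "cnj \<zeta> = 1 / \<zeta>" "cis (- (2 * pi * \<theta>)) = 1 / \<zeta>"
    using ne by (simp_all add: \<zeta>_def cis_cnj cis_inverse inverse_eq_divide[symmetric])
  have t: "of_real t = \<i> * (1 + \<zeta>) / (1 - \<zeta>)"
  proof -
    have "cnj (inverse_cayley \<zeta>) = inverse_cayley \<zeta>"
      using \<zeta>(1,2) by (simp add: inverse_cayley_def \<zeta>(3) divide_simps) (simp add: algebra_simps)
    then have "inverse_cayley \<zeta> \<in> \<real>" by (simp add: Reals_cnj_iff)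
    then have "of_real (Re (inverse_cayley \<zeta>)) = inverse_cayley \<zeta>" by (rule of_real_Re)
    then show ?thesis unfolding t_def boundary_point_def \<zeta>_def[symmetric] by (simp add: inverse_cayley_def)
  qed
  have nz: "of_real t - z \<noteq> 0" "of_real t + \<i> \<noteq> 0" "of_real t - \<i> \<noteq> 0" "z + \<i> \<noteq> 0"
    using z by (auto simp: complex_eq_iff)
  have inv: "1 / \<zeta> = (of_real t + \<i>) / (of_real t - \<i>)"
  proof -
    have "of_real t + \<i> = 2 * \<i> / (1 - \<zeta>)" "of_real t - \<i> = 2 * \<i> * \<zeta> / (1 - \<zeta>)"
      unfolding t using \<zeta>(1) by (simp_all add: field_simps)
    then show ?thesis using \<zeta> by simp
  qed
  have t2: "complex_of_real (1 + t\<^sup>2) = (of_real t + \<i>) * (of_real t - \<i>)"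
    by (simp add: algebra_simps power2_eq_square)
  have "1 - cayley z * (1 / \<zeta>) = 2 * \<i> * (of_real t - z) / ((z + \<i>) * (of_real t - \<i>))"
  proof -
    have "(z + \<i>) * (of_real t - \<i>) - (z - \<i>) * (of_real t + \<i>) = 2 * \<i> * (of_real t - z)"
      by (simp add: algebra_simps)
    moreover have "1 - a / b * (c / d) = (b * d - a * c) / (b * d)" if "b \<noteq> 0" "d \<noteq> 0" for a b c d :: complex
      using that by (simp add: field_simps)
    ultimately show ?thesis unfolding inv cayley_def using nz by simp
  qed
  then have sz: "szego (cayley z) \<theta> = (z + \<i>) * (of_real t - \<i>) / (2 * \<i> * (of_real t - z))"
    unfolding szego_def \<zeta>(4) by simp
  have sz1: "szego (cayley z) \<theta> - 1 = (z - \<i>) * (of_real t + \<i>) / (2 * \<i> * (of_real t - z))"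
  proof -
    have "(z + \<i>) * (of_real t - \<i>) - 2 * \<i> * (of_real t - z) = (z - \<i>) * (of_real t + \<i>)"
      by (simp add: algebra_simps)
    moreover have "a / b - 1 = (a - b) / b" if "b \<noteq> 0" for a b :: complex
      using that by (simp add: field_simps)
    ultimately show ?thesis unfolding sz using nz(1) by simp
  qed
  have e: "2 * \<i> * (A * B / (2 * \<i> * C)) / D = A * B / (C * D)" for A B C D :: complex by simp
  show "1 / (of_real t - z) - 1 / (of_real t + \<i>) = 2 * \<i> * szego (cayley z) \<theta> / of_real (1 + t\<^sup>2)"
  proof -
    have "2 * \<i> * szego (cayley z) \<theta> / of_real (1 + t\<^sup>2)
      = (z + \<i>) * (of_real t - \<i>) / ((of_real t - z) * ((of_real t + \<i>) * (of_real t - \<i>)))"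
      unfolding sz e t2 ..
    also have "\<dots> = (z + \<i>) / ((of_real t - z) * (of_real t + \<i>))" using nz(3) by simp
    also have "\<dots> = 1 / (of_real t - z) - 1 / (of_real t + \<i>)"
      using nz by (simp add: diff_frac_eq)
    finally show ?thesis ..
  qed
  show "1 / (of_real t - z) - 1 / (of_real t - \<i>) = 2 * \<i> * (szego (cayley z) \<theta> - 1) / of_real (1 + t\<^sup>2)"
  proof -
    have "2 * \<i> * (szego (cayley z) \<theta> - 1) / of_real (1 + t\<^sup>2)
      = (z - \<i>) * (of_real t + \<i>) / ((of_real t - z) * ((of_real t + \<i>) * (of_real t - \<i>)))"
      unfolding sz1 e t2 ..
    also have "\<dots> = (z - \<i>) / ((of_real t - z) * (of_real t - \<i>))" using nz(2) by simp
    also have "\<dots> = 1 / (of_real t - z) - 1 / (of_real t - \<i>)"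
      using nz by (simp add: diff_frac_eq)
    finally show ?thesis ..
  qed
qed

text \<open>
  The dictionary between the plane and the torus: up to the growth weight, the kernel of the
  representation and the integrand of the Nevanlinna condition are the two combinations of Szego
  kernels that occur on the bidisc.
\<close>

lemma boundary_weight_kernels:
  assumes ne: "cis (2 * pi * \<theta>1) \<noteq> 1" "cis (2 * pi * \<theta>2) \<noteq> 1" and z: "Im z1 > 0" "Im z2 > 0"
  defines "t1 \<equiv> boundary_point \<theta>1" and "t2 \<equiv> boundary_point \<theta>2"
  shows "of_real ((1 + t1\<^sup>2) * (1 + t2\<^sup>2)) * kernel2 (z1, z2) (t1, t2)
      = \<i> * (2 * (szego (cayley z1) \<theta>1 * szego (cayley z2) \<theta>2) - 1)"
    and "of_real ((1 + t1\<^sup>2) * (1 + t2\<^sup>2)) * ((1 / (of_real t1 - cnj z1) - 1 / (of_real t1 + \<i>))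
                     * (1 / (of_real t2 - z2) - 1 / (of_real t2 - \<i>)))
      = 4 * (cnj (szego (cayley z1) \<theta>1 - 1) * (szego (cayley z2) \<theta>2 - 1))"
proof -
  have pos: "complex_of_real (1 + t1\<^sup>2) \<noteq> 0" "complex_of_real (1 + t2\<^sup>2) \<noteq> 0"
    by (metis add_pos_nonneg less_irrefl of_real_eq_0_iff zero_le_power2 zero_less_one)+
  note I1 = boundary_point_identities[OF ne(1) z(1), folded t1_def]
  note I2 = boundary_point_identities[OF ne(2) z(2), folded t2_def]
  have e: "a * b * (- (\<i>/2) * (2 * \<i> * x / a) * (2 * \<i> * y / b) - \<i> / (a * b)) = \<i> * (2 * (x * y) - 1)"
    if "a \<noteq> 0" "b \<noteq> 0" for a b x y :: complex
    using that by (simp add: field_simps)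
  show "of_real ((1 + t1\<^sup>2) * (1 + t2\<^sup>2)) * kernel2 (z1, z2) (t1, t2)
      = \<i> * (2 * (szego (cayley z1) \<theta>1 * szego (cayley z2) \<theta>2) - 1)"
    unfolding kernel2_def prod.case I1 I2 of_real_mult by (rule e[OF pos])
  have c: "1 / (of_real t1 - cnj z1) - 1 / (of_real t1 + \<i>) = cnj (1 / (of_real t1 - z1) - 1 / (of_real t1 - \<i>))"
    by simp
  have e': "a * b * ((- (2 * \<i>) * x / a) * (2 * \<i> * y / b)) = 4 * (x * y)"
    if "a \<noteq> 0" "b \<noteq> 0" for a b x y :: complex
    using that by (simp add: field_simps)
  have c': "cnj (2 * \<i> * x / of_real r) = - (2 * \<i>) * cnj x / of_real r" for x r by simp
  show "of_real ((1 + t1\<^sup>2) * (1 + t2\<^sup>2)) * ((1 / (of_real t1 - cnj z1) - 1 / (of_real t1 + \<i>))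
                     * (1 / (of_real t2 - z2) - 1 / (of_real t2 - \<i>)))
      = 4 * (cnj (szego (cayley z1) \<theta>1 - 1) * (szego (cayley z2) \<theta>2 - 1))"
    unfolding c I1 I2 c' of_real_mult by (rule e'[OF pos])
qed

lemma holomorphic2_on_imp:
  assumes q: "holomorphic2_on q S" and S: "open S"
  shows "continuous_on S q"
    and "(z1, z2) \<in> S \<Longrightarrow> (\<lambda>u. q (u, z2)) field_differentiable at z1"
    and "(z1, z2) \<in> S \<Longrightarrow> (\<lambda>u. q (z1, u)) field_differentiable at z2"
proof -
  have D: "\<exists>c1 c2. (q has_derivative (\<lambda>(h1, h2). c1 * h1 + c2 * h2)) (at z)" if "z \<in> S" for z
  proof -
    have "\<exists>c1 c2. (q has_derivative (\<lambda>(h1, h2). c1 * h1 + c2 * h2)) (at z within S)"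
      using q that unfolding holomorphic2_on_def by (rule bspec)
    then show ?thesis unfolding at_within_open[OF that S] .
  qed
  show "continuous_on S q"
    using D by (meson continuous_at_imp_continuous_on has_derivative_continuous)
  assume "(z1, z2) \<in> S"
  then obtain c1 c2 where c: "(q has_derivative (\<lambda>(h1, h2). c1 * h1 + c2 * h2)) (at (z1, z2))" using D by blast
  have "((\<lambda>u. q (u, z2)) has_derivative (\<lambda>h. (\<lambda>(h1, h2). c1 * h1 + c2 * h2) (h, 0))) (at z1)"
    by (rule has_derivative_compose[where f="\<lambda>u. (u, z2)", OF _ c]) (auto intro!: derivative_eq_intros)
  then show "(\<lambda>u. q (u, z2)) field_differentiable at z1"
    by (auto simp: field_differentiable_def has_field_derivative_def)
  have "((\<lambda>u. q (z1, u)) has_derivative (\<lambda>h. (\<lambda>(h1, h2). c1 * h1 + c2 * h2) (0, h))) (at z2)"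
    by (rule has_derivative_compose[where f="\<lambda>u. (z1, u)", OF _ c]) (auto intro!: derivative_eq_intros)
  then show "(\<lambda>u. q (z1, u)) field_differentiable at z2"
    by (auto simp: field_differentiable_def has_field_derivative_def)
qed

lemma open_upper_half_plane2: "open upper_half_plane2"
proof -
  have "upper_half_plane2 = {z. Im z > 0} \<times> {z. Im z > 0}" by (auto simp: upper_half_plane2_def)
  moreover have "open ({z. Im z > 0} \<times> {z. Im z > 0})"
    by (intro open_Times open_halfspace_Im_gt)
  ultimately show ?thesis by simp
qed

text \<open>
  Frechet differentiability gives continuity and, restricted to the coordinate lines, holomorphy in each
  variable; both are preserved by the inverse Cayley transform.
\<close>

lemma bidisc_holomorphic_cayley:
  assumes q: "holomorphic2_on q upper_half_plane2"
  shows "bidisc_holomorphic 1 (\<lambda>w. - \<i> * q (inverse_cayley (fst w), inverse_cayley (snd w)))"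
proof -
  note Q = holomorphic2_on_imp[OF q open_upper_half_plane2]
  have ne: "1 - w \<noteq> 0" if "w \<in> ball 0 1" for w :: complex using that by auto
  have hol: "inverse_cayley holomorphic_on ball 0 1"
    unfolding inverse_cayley_def using ne by (intro holomorphic_intros) auto
  have up: "(inverse_cayley w1, inverse_cayley w2) \<in> upper_half_plane2" if "w1 \<in> ball 0 1" "w2 \<in> ball 0 1" for w1 w2
    using that Im_inverse_cayley by (auto simp: upper_half_plane2_def)
  have ct: "continuous_on (ball 0 1) inverse_cayley" using hol by (rule holomorphic_on_imp_continuous_on)
  have "continuous_on (ball 0 1 \<times> ball 0 1) (\<lambda>w. q (inverse_cayley (fst w), inverse_cayley (snd w)))"
  proof (rule continuous_on_compose2[OF Q(1)])
    have "continuous_on (ball 0 1 \<times> ball 0 1) (\<lambda>w::complex \<times> complex. inverse_cayley (fst w))"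
      by (rule continuous_on_compose2[OF ct]) (auto intro!: continuous_intros simp only: mem_Times_iff fst_conv snd_conv)
    moreover have "continuous_on (ball 0 1 \<times> ball 0 1) (\<lambda>w::complex \<times> complex. inverse_cayley (snd w))"
      by (rule continuous_on_compose2[OF ct]) (auto intro!: continuous_intros simp only: mem_Times_iff fst_conv snd_conv)
    ultimately show "continuous_on (ball 0 1 \<times> ball 0 1) (\<lambda>w. (inverse_cayley (fst w), inverse_cayley (snd w)))"
      by (rule continuous_on_Pair)
    show "(\<lambda>w. (inverse_cayley (fst w), inverse_cayley (snd w))) ` (ball 0 1 \<times> ball 0 1) \<subseteq> upper_half_plane2"
      by (intro image_subsetI up) (simp_all only: mem_Times_iff)
  qed
  then have "continuous_on (ball 0 1 \<times> ball 0 1) (\<lambda>w. - \<i> * q (inverse_cayley (fst w), inverse_cayley (snd w)))"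
    by (rule continuous_on_mult_left)
  moreover have "(\<lambda>u. - \<i> * q (inverse_cayley u, inverse_cayley w)) holomorphic_on ball 0 1"
    "(\<lambda>u. - \<i> * q (inverse_cayley w, inverse_cayley u)) holomorphic_on ball 0 1" if w: "w \<in> ball 0 1" for w
  proof -
    have U: "(u, inverse_cayley w) \<in> upper_half_plane2 \<and> (inverse_cayley w, u) \<in> upper_half_plane2" if "Im u > 0" for u
      using Im_inverse_cayley[of w] w that by (simp add: upper_half_plane2_def)
    have "(\<lambda>u. q (u, inverse_cayley w)) holomorphic_on {z. Im z > 0}"
    proof (rule holomorphic_onI)
      fix u assume "u \<in> {z. Im z > 0}"
      then have "(\<lambda>u. q (u, inverse_cayley w)) field_differentiable at u" using U[of u] Q(2) by blast
      then show "(\<lambda>u. q (u, inverse_cayley w)) field_differentiable at u within {z. Im z > 0}"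
        by (rule field_differentiable_at_within)
    qed
    moreover have "(\<lambda>u. q (inverse_cayley w, u)) holomorphic_on {z. Im z > 0}"
    proof (rule holomorphic_onI)
      fix u assume "u \<in> {z. Im z > 0}"
      then have "(\<lambda>u. q (inverse_cayley w, u)) field_differentiable at u" using U[of u] Q(3) by blast
      then show "(\<lambda>u. q (inverse_cayley w, u)) field_differentiable at u within {z. Im z > 0}"
        by (rule field_differentiable_at_within)
    qed
    moreover have "inverse_cayley ` ball 0 1 \<subseteq> {z. Im z > 0}" using Im_inverse_cayley by auto
    ultimately have "(\<lambda>u. q (u, inverse_cayley w)) \<circ> inverse_cayley holomorphic_on ball 0 1"
      "(\<lambda>u. q (inverse_cayley w, u)) \<circ> inverse_cayley holomorphic_on ball 0 1"
      using holomorphic_on_compose_gen[OF hol, of "\<lambda>u. q (u, inverse_cayley w)" "{z. Im z > 0}"]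
        holomorphic_on_compose_gen[OF hol, of "\<lambda>u. q (inverse_cayley w, u)" "{z. Im z > 0}"] by simp_all
    then show "(\<lambda>u. - \<i> * q (inverse_cayley u, inverse_cayley w)) holomorphic_on ball 0 1"
      "(\<lambda>u. - \<i> * q (inverse_cayley w, inverse_cayley u)) holomorphic_on ball 0 1"
      unfolding o_def by (simp_all add: holomorphic_on_minus holomorphic_on_mult)
  qed
  ultimately show ?thesis by (simp add: bidisc_holomorphic_def)
qed

section \<open>The integral representation defines a Herglotz-Nevanlinna function\<close>

lemma has_derivative_at_quadratic_remainder:
  fixes f :: "'a::real_normed_vector \<Rightarrow> 'b::real_normed_vector"
  assumes L: "bounded_linear L" and d: "d > 0"
    and rem: "\<And>h. norm h < d \<Longrightarrow> norm (f (x + h) - f x - L h) \<le> C * (norm h)\<^sup>2"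
  shows "(f has_derivative L) (at x)"
  unfolding has_derivative_at
proof (intro conjI L)
  have "\<forall>\<^sub>F h in at 0. norm h < d"
    unfolding eventually_at using d by (intro exI[of _ d]) auto
  then have "\<forall>\<^sub>F h in at 0. norm (f (x + h) - f x - L h) / norm h \<le> C * norm h"
    by eventually_elim (use rem in \<open>auto simp: divide_le_eq power2_eq_square mult.assoc split: if_splits\<close>)
  then show "(\<lambda>h. norm (f (x + h) - f x - L h) / norm h) \<midarrow>0\<rightarrow> 0"
  proof (rule tendsto_sandwich[of "\<lambda>_. 0", rotated])
    show "((\<lambda>h. C * norm h) \<longlongrightarrow> 0) (at 0)" by (auto intro!: tendsto_eq_intros)
  qed auto
qed

lemma norm_real_plus_i: "norm (of_real t + \<i>) = sqrt (1 + t\<^sup>2)" "norm (of_real t - \<i>) = sqrt (1 + t\<^sup>2)"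
  by (simp_all add: cmod_def add.commute)

text \<open>
  The bound |t + i| \<le> |t - z| + |z + i| \<le> |t - z| (1 + |z + i| / Im z), made uniform in a neighbourhood
  of a point by means of y and m.
\<close>

lemma norm_inverse_le:
  assumes "Im z \<ge> y" "y > 0" "norm (z + \<i>) \<le> m"
  shows "norm (1 / (of_real t - z)) \<le> (1 + m / y) / sqrt (1 + t\<^sup>2)"
proof -
  have "\<bar>Im (of_real t - z)\<bar> \<le> norm (of_real t - z)" by (rule abs_Im_le_cmod)
  then have y: "y \<le> norm (of_real t - z)" using assms by simp
  have m: "0 \<le> m" using assms(3) norm_ge_zero order_trans by blast
  have "norm (of_real t + \<i>) \<le> norm (of_real t - z) + norm (z + \<i>)"
    using norm_triangle_ineq[of "of_real t - z" "z + \<i>"] by simp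
  also have "norm (z + \<i>) \<le> norm (of_real t - z) * (m / y)"
  proof -
    have "norm (z + \<i>) \<le> y * (m / y)" using assms by simp
    also have "\<dots> \<le> norm (of_real t - z) * (m / y)" using y m assms by (intro mult_right_mono) auto
    finally show ?thesis .
  qed
  finally have "sqrt (1 + t\<^sup>2) \<le> norm (of_real t - z) * (1 + m / y)"
    by (simp add: norm_real_plus_i distrib_left)
  moreover have "0 < norm (of_real t - z)" using y assms(2) by linarith
  moreover have "0 < sqrt (1 + t\<^sup>2)" by (simp add: add_pos_nonneg)
  ultimately show ?thesis by (simp add: norm_divide field_simps)
qed

text \<open>
  The size of the factors of both kernels, and the first order Taylor expansion of 1 / (t - z) in z. A
  single constant serves all bounds, and each bound decays like 1 / (1 + t^2), which is what the growth
  condition can integrate in each variable.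
\<close>

lemma kernel_factor_estimates:
  assumes z: "Im z > 0"
  obtains B d where "B > 0" "d > 0"
    "\<And>h. norm h < d \<Longrightarrow> Im (z + h) > 0"
    "\<And>t. norm (1 / (of_real t - z) - 1 / (of_real t + \<i>)) \<le> B / (1 + t\<^sup>2)"
    "\<And>t. norm (1 / (of_real t - z) - 1 / (of_real t - \<i>)) \<le> B / (1 + t\<^sup>2)"
    "\<And>t. norm (1 / (of_real t - z)\<^sup>2) \<le> B / (1 + t\<^sup>2)"
    "\<And>t h. norm h < d \<Longrightarrow> norm (1 / (of_real t - (z + h)) - 1 / (of_real t - z)) \<le> B * norm h / (1 + t\<^sup>2)"
    "\<And>t h. norm h < d \<Longrightarrow> norm (1 / (of_real t - (z + h)) - 1 / (of_real t - z) - h / (of_real t - z)\<^sup>2)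
        \<le> B * (norm h)\<^sup>2 / (1 + t\<^sup>2)"
proof -
  \<comment> \<open>points at distance less than y from z have imaginary part above y\<close>
  define y where "y = Im z / 2"
  define m where "m = norm (z + \<i>) + y"
  define b where "b = 1 + m / y"
  \<comment> \<open>the sum of the constants of the individual estimates below\<close>
  define B where "B = b\<^sup>2 + b * m + b * (norm (z - \<i>)) + b ^ 3"
  have y: "y > 0" using z by (simp add: y_def)
  have m: "m > 0" using y by (simp add: m_def add_nonneg_pos)
  have b: "b > 1" using y m by (simp add: b_def)
  have b2: "0 < b\<^sup>2" "0 < b ^ 3" "0 < b * m" "0 \<le> b * norm (z - \<i>)" using b m by auto
  have B: "B > 0" "b\<^sup>2 \<le> B" "b * m \<le> B" "b * norm (z - \<i>) \<le> B" "b ^ 3 \<le> B"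
    using b2 unfolding B_def by linarith+
  have s: "sqrt (1 + t\<^sup>2) * sqrt (1 + t\<^sup>2) = 1 + t\<^sup>2" "sqrt (1 + t\<^sup>2) \<ge> 1" "1 + t\<^sup>2 > 0" for t :: real
    by (auto simp: add_pos_nonneg)
  have im: "Im (z + h) > y" if "norm h < y" for h
    using abs_Im_le_cmod[of h] that by (simp add: y_def)
  have w': "norm (1 / (of_real t - (z + h))) \<le> b / sqrt (1 + t\<^sup>2)" if "norm h < y" for t h
  proof -
    have "norm (z + h + \<i>) \<le> m" using norm_triangle_ineq[of "z + \<i>" h] that by (simp add: m_def add_ac)
    then show ?thesis unfolding b_def using im[OF that] y by (intro norm_inverse_le) auto
  qed
  have w: "norm (1 / (of_real t - z)) \<le> b / sqrt (1 + t\<^sup>2)" for t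
    using w'[of 0] y by simp
  have wb: "norm (1 / (of_real t - z)) \<le> b" for t
  proof -
    have "b / sqrt (1 + t\<^sup>2) \<le> b / 1" using b s(2)[of t] by (intro divide_left_mono) (auto simp: s(3))
    then show ?thesis using w[of t] by simp
  qed
  have nz: "of_real t - z \<noteq> 0" "of_real t + \<i> \<noteq> 0" "of_real t - \<i> \<noteq> 0" for t
    using z by (auto simp: complex_eq_iff)
  have nz': "of_real t - (z + h) \<noteq> 0" if "norm h < y" for t h
    using im[OF that] y by (auto simp: complex_eq_iff)
  have two: "norm a * norm c \<le> k * l / (1 + t\<^sup>2)"
    if "norm a \<le> k / sqrt (1 + t\<^sup>2)" "norm c \<le> l / sqrt (1 + t\<^sup>2)" "0 \<le> k" for a c :: complex and t k l
  proof -
    have "norm a * norm c \<le> (k / sqrt (1 + t\<^sup>2)) * (l / sqrt (1 + t\<^sup>2))"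
      using that s(2)[of t] by (intro mult_mono) auto
    also have "\<dots> = k * l / (1 + t\<^sup>2)" by (simp only: times_divide_times_eq s(1))
    finally show ?thesis .
  qed
  have diff: "norm (1 / (of_real t - (z + h)) - 1 / (of_real t - z)) \<le> b\<^sup>2 * norm h / (1 + t\<^sup>2)" if h: "norm h < y" for t h
  proof -
    have "1 / (of_real t - (z + h)) - 1 / (of_real t - z) = h * (1 / (of_real t - (z + h)) * (1 / (of_real t - z)))"
      using nz(1)[of t] nz'[OF h, of t] by (simp add: divide_simps)
    then have "norm (1 / (of_real t - (z + h)) - 1 / (of_real t - z))
       = norm h * (norm (1 / (of_real t - (z + h))) * norm (1 / (of_real t - z)))" by (simp only: norm_mult)
    also have "\<dots> \<le> norm h * (b * b / (1 + t\<^sup>2))"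
      using two[OF w'[OF h] w] b by (intro mult_left_mono) auto
    finally show ?thesis by (simp add: power2_eq_square mult_ac)
  qed
  have mono: "c * x / (1 + t\<^sup>2) \<le> B * x / (1 + t\<^sup>2)" if "c \<le> B" "0 \<le> x" for c x t :: real
    using that s(3)[of t] by (intro divide_right_mono mult_right_mono) auto
  have mono1: "c / (1 + t\<^sup>2) \<le> B / (1 + t\<^sup>2)" if "c \<le> B" for c t :: real
    using mono[OF that, of 1] by simp
  have inv1: "norm (1 / (of_real t + \<i>)) \<le> 1 / sqrt (1 + t\<^sup>2)"
    and inv2: "norm (1 / (of_real t - \<i>)) \<le> 1 / sqrt (1 + t\<^sup>2)" for t
    unfolding norm_divide norm_real_plus_i by simp_all
  show ?thesis
  proof (rule that[OF B(1) y])
    show "Im (z + h) > 0" if "norm h < y" for h using im[OF that] y by linarith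
    fix t
    have "1 / (of_real t - z) - 1 / (of_real t + \<i>) = (z + \<i>) * (1 / (of_real t - z) * (1 / (of_real t + \<i>)))"
      using nz[of t] by (simp add: divide_simps)
    then have "norm (1 / (of_real t - z) - 1 / (of_real t + \<i>))
        = norm (z + \<i>) * (norm (1 / (of_real t - z)) * norm (1 / (of_real t + \<i>)))" by (simp only: norm_mult)
    also have "\<dots> \<le> m * (b * 1 / (1 + t\<^sup>2))"
      using two[OF w[of t] inv1[of t]] b m y
      by (intro mult_mono) (auto simp: m_def simp del: norm_divide)
    also have "\<dots> = b * m / (1 + t\<^sup>2)" by simp
    also have "\<dots> \<le> B / (1 + t\<^sup>2)" by (rule mono1[OF B(3)])
    finally show "norm (1 / (of_real t - z) - 1 / (of_real t + \<i>)) \<le> B / (1 + t\<^sup>2)" .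
    have "1 / (of_real t - z) - 1 / (of_real t - \<i>) = (z - \<i>) * (1 / (of_real t - z) * (1 / (of_real t - \<i>)))"
      using nz[of t] by (simp add: divide_simps)
    then have "norm (1 / (of_real t - z) - 1 / (of_real t - \<i>))
        = norm (z - \<i>) * (norm (1 / (of_real t - z)) * norm (1 / (of_real t - \<i>)))" by (simp only: norm_mult)
    also have "\<dots> \<le> norm (z - \<i>) * (b * 1 / (1 + t\<^sup>2))"
      using two[OF w[of t] inv2[of t]] b
      by (intro mult_mono) auto
    also have "\<dots> = b * norm (z - \<i>) / (1 + t\<^sup>2)" by simp
    also have "\<dots> \<le> B / (1 + t\<^sup>2)" by (rule mono1[OF B(4)])
    finally show "norm (1 / (of_real t - z) - 1 / (of_real t - \<i>)) \<le> B / (1 + t\<^sup>2)" .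
    have "norm (1 / (of_real t - z)\<^sup>2) = norm (1 / (of_real t - z)) * norm (1 / (of_real t - z))"
      by (simp add: norm_divide norm_mult power2_eq_square)
    also have "\<dots> \<le> b * b / (1 + t\<^sup>2)" using b by (intro two w) auto
    also have "\<dots> \<le> B / (1 + t\<^sup>2)" using B(2) by (intro mono1) (simp add: power2_eq_square)
    finally show "norm (1 / (of_real t - z)\<^sup>2) \<le> B / (1 + t\<^sup>2)" .
    fix h :: complex assume h: "norm h < y"
    show "norm (1 / (of_real t - (z + h)) - 1 / (of_real t - z)) \<le> B * norm h / (1 + t\<^sup>2)"
      using diff[OF h] mono[OF B(2)] order_trans norm_ge_zero by blast
    have "1 / (of_real t - (z + h)) - 1 / (of_real t - z) - h / (of_real t - z)\<^sup>2
      = h * (1 / (of_real t - z)) * (1 / (of_real t - (z + h)) - 1 / (of_real t - z))"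
      using nz(1)[of t] nz'[OF h, of t] by (simp add: divide_simps power2_eq_square) (simp add: algebra_simps)
    then have "norm (1 / (of_real t - (z + h)) - 1 / (of_real t - z) - h / (of_real t - z)\<^sup>2)
      = norm h * norm (1 / (of_real t - z)) * norm (1 / (of_real t - (z + h)) - 1 / (of_real t - z))"
      by (simp only: norm_mult)
    also have "\<dots> \<le> norm h * b * (b\<^sup>2 * norm h / (1 + t\<^sup>2))"
      using b wb by (intro mult_mono mult_left_mono diff h) auto
    also have "\<dots> = b ^ 3 * (norm h)\<^sup>2 / (1 + t\<^sup>2)" by (simp add: power2_eq_square power3_eq_cube)
    also have "\<dots> \<le> B * (norm h)\<^sup>2 / (1 + t\<^sup>2)" by (rule mono[OF B(5)]) simp
    finally show "norm (1 / (of_real t - (z + h)) - 1 / (of_real t - z) - h / (of_real t - z)\<^sup>2)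
        \<le> B * (norm h)\<^sup>2 / (1 + t\<^sup>2)" .
  qed
qed

definition weight2 :: "real \<times> real \<Rightarrow> real" where
  "weight2 = (\<lambda>(t1, t2). 1 / ((1 + t1\<^sup>2) * (1 + t2\<^sup>2)))"

lemma weight2_nonneg: "0 \<le> weight2 t"
  by (cases t) (simp add: weight2_def)

lemma integrable_weight2:
  assumes "sets \<mu> = sets borel" "growth_condition2 \<mu>"
  shows "integrable \<mu> weight2"
proof (rule integrableI_nonneg)
  note assms(1)[measurable_cong]
  have "weight2 \<in> borel_measurable borel" unfolding weight2_def borel_prod[symmetric] by measurable
  then show "weight2 \<in> borel_measurable \<mu>" by (simp cong: measurable_cong_sets add: assms(1))
  show "(\<integral>\<^sup>+ t. ennreal (weight2 t) \<partial>\<mu>) < \<infinity>"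
    using assms(2) unfolding growth_condition2_def weight2_def by (simp add: case_prod_unfold)
qed (simp add: weight2_nonneg)

lemma integrable_bounded_by_weight2:
  fixes g :: "real \<times> real \<Rightarrow> 'b::{banach, second_countable_topology}"
  assumes "sets \<mu> = sets borel" "growth_condition2 \<mu>" "g \<in> borel_measurable borel"
    and le: "\<And>t. norm (g t) \<le> C * weight2 t"
  shows "integrable \<mu> g"
proof (rule Bochner_Integration.integrable_bound)
  show "integrable \<mu> (\<lambda>t. C * weight2 t)" using integrable_weight2[OF assms(1,2)] by simp
  show "g \<in> borel_measurable \<mu>" using assms(3) by (simp cong: measurable_cong_sets add: assms(1))
  have "norm (g t) \<le> norm (C * weight2 t)" for t using le[of t] by simp
  then show "AE t in \<mu>. norm (g t) \<le> norm (C * weight2 t)" by simp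
qed

lemma mult_le_weight2:
  assumes "norm a \<le> k / (1 + (fst t)\<^sup>2)" "norm b \<le> l / (1 + (snd t)\<^sup>2)"
  shows "norm (a * b :: complex) \<le> k * l * weight2 t"
proof -
  have "0 \<le> k / (1 + (fst t)\<^sup>2)" using assms(1) norm_ge_zero order_trans by blast
  then have "norm a * norm b \<le> (k / (1 + (fst t)\<^sup>2)) * (l / (1 + (snd t)\<^sup>2))"
    using assms by (intro mult_mono) auto
  then show ?thesis by (simp add: norm_mult weight2_def case_prod_beta)
qed

lemma kernel2_altdef:
  "kernel2 (z1, z2) t = - (\<i> / 2) * ((1 / (of_real (fst t) - z1) - 1 / (of_real (fst t) + \<i>))
      * (1 / (of_real (snd t) - z2) - 1 / (of_real (snd t) + \<i>))) - \<i> * of_real (weight2 t)"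
  by (simp add: kernel2_def weight2_def case_prod_beta)

definition nevanlinna_integrand2 :: "complex \<Rightarrow> complex \<Rightarrow> real \<times> real \<Rightarrow> real" where
  "nevanlinna_integrand2 z1 z2 t = Re ((1 / (of_real (fst t) - cnj z1) - 1 / (of_real (fst t) + \<i>))
                     * (1 / (of_real (snd t) - z2) - 1 / (of_real (snd t) - \<i>)))"

lemma kernel_integrable:
  assumes \<mu>: "sets \<mu> = sets borel" "growth_condition2 \<mu>" and z: "Im z1 > 0" "Im z2 > 0"
  shows "integrable \<mu> (kernel2 (z1, z2))" "integrable \<mu> (nevanlinna_integrand2 z1 z2)"
proof -
  obtain B1 where B1: "\<And>t. norm (1 / (of_real t - z1) - 1 / (of_real t + \<i>)) \<le> B1 / (1 + t\<^sup>2)"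
    "\<And>t. norm (1 / (of_real t - z1) - 1 / (of_real t - \<i>)) \<le> B1 / (1 + t\<^sup>2)"
    by (rule kernel_factor_estimates[OF z(1)]) blast
  obtain B2 where B2: "\<And>t. norm (1 / (of_real t - z2) - 1 / (of_real t + \<i>)) \<le> B2 / (1 + t\<^sup>2)"
    "\<And>t. norm (1 / (of_real t - z2) - 1 / (of_real t - \<i>)) \<le> B2 / (1 + t\<^sup>2)"
    by (rule kernel_factor_estimates[OF z(2)]) blast
  have "integrable \<mu> (\<lambda>t. (1 / (of_real (fst t) - z1) - 1 / (of_real (fst t) + \<i>))
      * (1 / (of_real (snd t) - z2) - 1 / (of_real (snd t) + \<i>)))"
    by (rule integrable_bounded_by_weight2[OF \<mu> _ mult_le_weight2])
       (unfold borel_prod[symmetric], measurable, rule B1, rule B2)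
  then show "integrable \<mu> (kernel2 (z1, z2))"
    unfolding kernel2_altdef using integrable_weight2[OF \<mu>] by simp
  have c: "norm (1 / (of_real t - cnj z1) - 1 / (of_real t + \<i>)) \<le> B1 / (1 + t\<^sup>2)" for t
  proof -
    have "1 / (of_real t - cnj z1) - 1 / (of_real t + \<i>) = cnj (1 / (of_real t - z1) - 1 / (of_real t - \<i>))"
      by simp
    then show ?thesis using B1(2)[of t] by (simp only: complex_mod_cnj)
  qed
  have "integrable \<mu> (\<lambda>t. (1 / (of_real (fst t) - cnj z1) - 1 / (of_real (fst t) + \<i>))
      * (1 / (of_real (snd t) - z2) - 1 / (of_real (snd t) - \<i>)))"
    by (rule integrable_bounded_by_weight2[OF \<mu> _ mult_le_weight2])
       (unfold borel_prod[symmetric], measurable, rule c, rule B2)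
  then show "integrable \<mu> (nevanlinna_integrand2 z1 z2)"
    unfolding nevanlinna_integrand2_def by (rule integrable_Re)
qed

text \<open>
  The first summand is the product of the Poisson kernels of the two half-planes, hence positive, and
  the second one integrates to 0 under the Nevanlinna condition.
\<close>

lemma Im_kernel2:
  assumes "Im z1 > 0" "Im z2 > 0"
  shows "Im (kernel2 (z1, z2) t) = Im (1 / (of_real (fst t) - z1)) * Im (1 / (of_real (snd t) - z2))
     - nevanlinna_integrand2 z1 z2 t / 2"
proof -
  define w1 w2 where "w1 = 1 / (of_real (fst t) - z1)" and "w2 = 1 / (of_real (snd t) - z2)"
  define c1 c2 where "c1 = 1 / (of_real (fst t) + \<i>)" and "c2 = 1 / (of_real (snd t) + \<i>)"
  have im: "Im (1 / (of_real x + \<i>)) = - 1 / (1 + x\<^sup>2)" for x :: real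
    by (simp add: Im_divide power2_eq_square add.commute)
  have W: "weight2 t = Im c1 * Im c2"
    unfolding c1_def c2_def im by (simp add: weight2_def case_prod_beta)
  have k: "kernel2 (z1, z2) t = - (\<i> / 2) * ((w1 - c1) * (w2 - c2)) - \<i> * of_real (Im c1 * Im c2)"
    unfolding kernel2_altdef W w1_def w2_def c1_def c2_def ..
  have "nevanlinna_integrand2 z1 z2 t = Re ((cnj w1 - c1) * (w2 - cnj c2))"
    unfolding nevanlinna_integrand2_def w1_def w2_def c1_def c2_def by simp
  then show ?thesis unfolding k w1_def[symmetric] w2_def[symmetric]
    by (simp add: field_simps)
qed

lemma Im_integral_kernel2_nonneg:
  assumes \<mu>: "sets \<mu> = sets borel" "growth_condition2 \<mu>" "nevanlinna_condition2 \<mu>" and z: "Im z1 > 0" "Im z2 > 0"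
  shows "Im (\<integral>t. kernel2 (z1, z2) t \<partial>\<mu>) \<ge> 0"
proof -
  note I = kernel_integrable[OF \<mu>(1,2) z]
  have "integral\<^sup>L \<mu> (nevanlinna_integrand2 z1 z2) = 0"
    using \<mu>(3) z unfolding nevanlinna_condition2_def nevanlinna_integrand2_def upper_half_plane2_def
    by (simp only: case_prod_unfold) force
  then have "Im (\<integral>t. kernel2 (z1, z2) t \<partial>\<mu>) = (\<integral>t. Im (kernel2 (z1, z2) t) + nevanlinna_integrand2 z1 z2 t / 2 \<partial>\<mu>)"
    using I by (subst Bochner_Integration.integral_add) (auto simp: integral_Im integrable_Im)
  also have "\<dots> = (\<integral>t. Im (1 / (of_real (fst t) - z1)) * Im (1 / (of_real (snd t) - z2)) \<partial>\<mu>)"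
    by (simp add: Im_kernel2[OF z])
  also have "\<dots> \<ge> 0"
  proof (rule Bochner_Integration.integral_nonneg)
    fix t
    have "Im (1 / (of_real x - z)) \<ge> 0" if "Im z > 0" for x :: real and z
      using that by (simp add: Im_divide)
    then show "Im (1 / (of_real (fst t) - z1)) * Im (1 / (of_real (snd t) - z2)) \<ge> 0" using z by simp
  qed
  finally show ?thesis .
qed

text \<open>
  Differentiation under the integral. The remainder of the product of the two kernel factors is the sum
  of a product of increments and two products of a factor with a remainder; all three are quadratic in
  the increment and dominated by the growth weight.
\<close>

lemma kernel_integral_quadratic_remainder:
  assumes \<mu>: "sets \<mu> = sets borel" "growth_condition2 \<mu>" and z: "Im z1 > 0" "Im z2 > 0"
  obtains c1 c2 C d where "d > 0"
    "\<And>h1 h2. norm (h1, h2) < d \<Longrightarrow> Im (z1 + h1) > 0 \<and> Im (z2 + h2) > 0 \<and>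
      norm ((\<integral>t. kernel2 (z1 + h1, z2 + h2) t \<partial>\<mu>) - (\<integral>t. kernel2 (z1, z2) t \<partial>\<mu>) - (c1 * h1 + c2 * h2))
        \<le> C * (norm (h1, h2))\<^sup>2"
proof -
  define w where "w z t = 1 / (of_real t - z)" for z :: complex and t :: real
  define a where "a z t = w z t - 1 / (of_real t + \<i>)" for z t
  obtain B1 d1 where B1: "B1 > 0" "d1 > 0"
    "\<And>h. norm h < d1 \<Longrightarrow> Im (z1 + h) > 0"
    "\<And>t. norm (a z1 t) \<le> B1 / (1 + t\<^sup>2)"
    "\<And>t. norm ((w z1 t)\<^sup>2) \<le> B1 / (1 + t\<^sup>2)"
    "\<And>t h. norm h < d1 \<Longrightarrow> norm (a (z1 + h) t - a z1 t) \<le> B1 * norm h / (1 + t\<^sup>2)"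
    "\<And>t h. norm h < d1 \<Longrightarrow> norm (a (z1 + h) t - a z1 t - h * (w z1 t)\<^sup>2) \<le> B1 * (norm h)\<^sup>2 / (1 + t\<^sup>2)"
    by (rule kernel_factor_estimates[OF z(1)]) (simp add: a_def w_def power_one_over)
  obtain B2 d2 where B2: "B2 > 0" "d2 > 0"
    "\<And>h. norm h < d2 \<Longrightarrow> Im (z2 + h) > 0"
    "\<And>t. norm (a z2 t) \<le> B2 / (1 + t\<^sup>2)"
    "\<And>t. norm ((w z2 t)\<^sup>2) \<le> B2 / (1 + t\<^sup>2)"
    "\<And>t h. norm h < d2 \<Longrightarrow> norm (a (z2 + h) t - a z2 t) \<le> B2 * norm h / (1 + t\<^sup>2)"
    "\<And>t h. norm h < d2 \<Longrightarrow> norm (a (z2 + h) t - a z2 t - h * (w z2 t)\<^sup>2) \<le> B2 * (norm h)\<^sup>2 / (1 + t\<^sup>2)"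
    by (rule kernel_factor_estimates[OF z(2)]) (simp add: a_def w_def power_one_over)
  have m: "(\<lambda>t. a z (fst t)) \<in> borel_measurable (borel :: (real \<times> real) measure)"
    "(\<lambda>t. a z (snd t)) \<in> borel_measurable (borel :: (real \<times> real) measure)"
    "(\<lambda>t. (w z (fst t))\<^sup>2) \<in> borel_measurable (borel :: (real \<times> real) measure)"
    "(\<lambda>t. (w z (snd t))\<^sup>2) \<in> borel_measurable (borel :: (real \<times> real) measure)" for z
    unfolding a_def w_def borel_prod[symmetric] by measurable
  define D1 where "D1 t = (w z1 (fst t))\<^sup>2 * a z2 (snd t)" for t
  define D2 where "D2 t = a z1 (fst t) * (w z2 (snd t))\<^sup>2" for t
  have D1: "integrable \<mu> D1" unfolding D1_def
    by (rule integrable_bounded_by_weight2[OF \<mu> _ mult_le_weight2]) (intro borel_measurable_times m, rule B1, rule B2)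
  have D2: "integrable \<mu> D2" unfolding D2_def
    by (rule integrable_bounded_by_weight2[OF \<mu> _ mult_le_weight2]) (intro borel_measurable_times m, rule B1, rule B2)
  define W where "W = integral\<^sup>L \<mu> weight2"
  define L1 where "L1 = - (\<i> / 2) * integral\<^sup>L \<mu> D1"
  define L2 where "L2 = - (\<i> / 2) * integral\<^sup>L \<mu> D2"
  define C where "C = 3 * (B1 * B2)"
  show ?thesis
  proof (rule that[of "min d1 d2" L1 L2 "C * W / 2"])
    show "min d1 d2 > 0" using B1 B2 by simp
    fix h1 h2 :: complex assume "norm (h1, h2) < min d1 d2"
    moreover have n: "norm h1 \<le> norm (h1, h2)" "norm h2 \<le> norm (h1, h2)"
      using norm_fst_le[of h1 h2] norm_snd_le[of h2 h1] by simp_all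
    ultimately have h: "norm h1 < d1" "norm h2 < d2" by auto
    note z' = B1(3)[OF h(1)] B2(3)[OF h(2)]
    define N where "N = norm (h1, h2)"
    define R where "R t = a (z1 + h1) (fst t) * a (z2 + h2) (snd t) - a z1 (fst t) * a z2 (snd t) - (h1 * D1 t + h2 * D2 t)" for t
    have Rle: "norm (R t) \<le> C * N\<^sup>2 * weight2 t" for t
    proof -
      define \<alpha> \<beta> where "\<alpha> = a (z1 + h1) (fst t) - a z1 (fst t)" and "\<beta> = a (z2 + h2) (snd t) - a z2 (snd t)"
      have "R t = \<alpha> * \<beta> + (\<alpha> - h1 * (w z1 (fst t))\<^sup>2) * a z2 (snd t) + a z1 (fst t) * (\<beta> - h2 * (w z2 (snd t))\<^sup>2)"
        unfolding R_def D1_def D2_def \<alpha>_def \<beta>_def by (simp add: algebra_simps)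
      also have "norm \<dots> \<le> norm (\<alpha> * \<beta>) + norm ((\<alpha> - h1 * (w z1 (fst t))\<^sup>2) * a z2 (snd t)) + norm (a z1 (fst t) * (\<beta> - h2 * (w z2 (snd t))\<^sup>2))"
        by (intro order_trans[OF norm_triangle_ineq] add_mono order_refl norm_triangle_ineq)
      also have "norm (\<alpha> * \<beta>) \<le> (B1 * norm h1) * (B2 * norm h2) * weight2 t"
        unfolding \<alpha>_def \<beta>_def using h by (intro mult_le_weight2 B1 B2)
      also have "\<dots> \<le> (B1 * N) * (B2 * N) * weight2 t"
        unfolding N_def using n B1(1) B2(1) by (intro mult_right_mono mult_mono weight2_nonneg) auto
      also have "norm ((\<alpha> - h1 * (w z1 (fst t))\<^sup>2) * a z2 (snd t)) \<le> (B1 * (norm h1)\<^sup>2) * B2 * weight2 t"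
        unfolding \<alpha>_def using h by (intro mult_le_weight2 B1 B2)
      also have "\<dots> \<le> (B1 * N\<^sup>2) * B2 * weight2 t"
        unfolding N_def using n B1(1) B2(1) by (intro mult_right_mono mult_left_mono power_mono weight2_nonneg) auto
      also have "norm (a z1 (fst t) * (\<beta> - h2 * (w z2 (snd t))\<^sup>2)) \<le> B1 * (B2 * (norm h2)\<^sup>2) * weight2 t"
        unfolding \<beta>_def using h by (intro mult_le_weight2 B1 B2)
      also have "\<dots> \<le> B1 * (B2 * N\<^sup>2) * weight2 t"
        unfolding N_def using n B1(1) B2(1) by (intro mult_right_mono mult_left_mono power_mono weight2_nonneg) auto
      finally show ?thesis unfolding C_def by (simp add: power2_eq_square mult_ac)
    qed
    have "R \<in> borel_measurable borel" unfolding R_def D1_def D2_def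
      by (intro borel_measurable_diff borel_measurable_add borel_measurable_times m borel_measurable_const)
    then have R: "integrable \<mu> R" by (rule integrable_bounded_by_weight2[OF \<mu> _ Rle])
    have "(\<integral>t. kernel2 (z1 + h1, z2 + h2) t \<partial>\<mu>) - (\<integral>t. kernel2 (z1, z2) t \<partial>\<mu>)
       = (\<integral>t. kernel2 (z1 + h1, z2 + h2) t - kernel2 (z1, z2) t \<partial>\<mu>)"
      using kernel_integrable(1)[OF \<mu> z] kernel_integrable(1)[OF \<mu> z'] by simp
    also have "\<dots> = (\<integral>t. - (\<i> / 2) * (R t + (h1 * D1 t + h2 * D2 t)) \<partial>\<mu>)"
      unfolding R_def kernel2_altdef a_def w_def
      by (intro Bochner_Integration.integral_cong refl) (simp add: right_diff_distrib)
    also have "\<dots> = - (\<i> / 2) * integral\<^sup>L \<mu> R + (L1 * h1 + L2 * h2)"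
      using R D1 D2 by (simp add: L1_def L2_def algebra_simps add_divide_distrib)
    finally have "norm ((\<integral>t. kernel2 (z1 + h1, z2 + h2) t \<partial>\<mu>) - (\<integral>t. kernel2 (z1, z2) t \<partial>\<mu>) - (L1 * h1 + L2 * h2))
       = norm (integral\<^sup>L \<mu> R) / 2"
      by (simp add: norm_mult)
    also have "norm (integral\<^sup>L \<mu> R) \<le> (\<integral>t. C * N\<^sup>2 * weight2 t \<partial>\<mu>)"
      by (rule Bochner_Integration.integral_norm_bound_integral[OF R _ Rle]) (use integrable_weight2[OF \<mu>] in simp)
    finally show "Im (z1 + h1) > 0 \<and> Im (z2 + h2) > 0 \<and>
      norm ((\<integral>t. kernel2 (z1 + h1, z2 + h2) t \<partial>\<mu>) - (\<integral>t. kernel2 (z1, z2) t \<partial>\<mu>) - (L1 * h1 + L2 * h2))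
        \<le> C * W / 2 * (norm (h1, h2))\<^sup>2"
      using z' by (simp add: W_def N_def mult_ac)
  qed
qed

lemma representation_imp_herglotz_nevanlinna2:
  assumes b: "b1 \<ge> 0" "b2 \<ge> 0" and \<mu>: "sets \<mu> = sets borel" "growth_condition2 \<mu>" "nevanlinna_condition2 \<mu>"
    and q: "\<And>z1 z2. Im z1 > 0 \<Longrightarrow> Im z2 > 0 \<Longrightarrow> q (z1, z2) = of_real a + of_real b1 * z1 + of_real b2 * z2
            + 1 / of_real (pi\<^sup>2) * (\<integral>t. kernel2 (z1, z2) t \<partial>\<mu>)"
  shows "herglotz_nevanlinna2 q"
  unfolding herglotz_nevanlinna2_def
proof (intro conjI ballI)
  fix z assume "z \<in> upper_half_plane2"
  then obtain z1 z2 where z: "z = (z1, z2)" "Im z1 > 0" "Im z2 > 0" by (auto simp: upper_half_plane2_def)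
  have "1 / complex_of_real (pi\<^sup>2) = of_real (1 / pi\<^sup>2)" by simp
  then show "Im (q z) \<ge> 0"
    using Im_integral_kernel2_nonneg[OF \<mu> z(2,3)] b z(2,3) by (simp add: z(1) q del: of_real_divide of_real_power)
next
  show "holomorphic2_on q upper_half_plane2"
    unfolding holomorphic2_on_def
  proof
    fix z assume "z \<in> upper_half_plane2"
    then obtain z1 z2 where z: "z = (z1, z2)" "Im z1 > 0" "Im z2 > 0" by (auto simp: upper_half_plane2_def)
    define J where "J u1 u2 = (\<integral>t. kernel2 (u1, u2) t \<partial>\<mu>)" for u1 u2
    obtain c1 c2 C d where d: "d > 0" and
      R: "\<And>h1 h2. norm (h1, h2) < d \<Longrightarrow> Im (z1 + h1) > 0 \<and> Im (z2 + h2) > 0 \<and>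
        norm (J (z1 + h1) (z2 + h2) - J z1 z2 - (c1 * h1 + c2 * h2)) \<le> C * (norm (h1, h2))\<^sup>2"
      unfolding J_def by (rule kernel_integral_quadratic_remainder[OF \<mu>(1,2) z(2,3)]) blast
    define k where "k = 1 / complex_of_real (pi\<^sup>2)"
    have q': "q (u1, u2) = of_real a + of_real b1 * u1 + of_real b2 * u2 + k * J u1 u2"
      if "Im u1 > 0" "Im u2 > 0" for u1 u2 using q[OF that] by (simp add: k_def J_def)
    define L where "L = (\<lambda>(h1, h2). (of_real b1 + k * c1) * h1 + (of_real b2 + k * c2) * h2)"
    have "(q has_derivative L) (at z)"
    proof (rule has_derivative_at_quadratic_remainder[OF _ d])
      show "bounded_linear L" unfolding L_def case_prod_beta
        by (intro bounded_linear_add bounded_linear_mult_right[THEN bounded_linear_compose] bounded_linear_fst bounded_linear_snd)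
      fix h :: "complex \<times> complex" assume h: "norm h < d"
      obtain h1 h2 where hh: "h = (h1, h2)" by (cases h)
      note r = R[of h1 h2, folded hh, OF h]
      have "q (z + h) - q z - L h = k * (J (z1 + h1) (z2 + h2) - J z1 z2 - (c1 * h1 + c2 * h2))"
        using r z by (simp add: hh q' L_def algebra_simps)
      then have "norm (q (z + h) - q z - L h) = norm k * norm (J (z1 + h1) (z2 + h2) - J z1 z2 - (c1 * h1 + c2 * h2))"
        by (simp only: norm_mult)
      also have "\<dots> \<le> norm k * (C * (norm h)\<^sup>2)" using r by (intro mult_left_mono) (auto simp: hh)
      finally show "norm (q (z + h) - q z - L h) \<le> (norm k * C) * (norm h)\<^sup>2" by (simp add: mult_ac)
    qed
    then show "\<exists>c1 c2. (q has_derivative (\<lambda>(h1, h2). c1 * h1 + c2 * h2)) (at z within upper_half_plane2)"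
      unfolding L_def using has_derivative_at_withinI by blast
  qed
qed

section \<open>The integral representation of a Herglotz-Nevanlinna function\<close>

lemma boundary_point_measurable [measurable]: "boundary_point \<in> borel_measurable borel"
  unfolding boundary_point_def inverse_cayley_def cis.code complex_eq_iff Complex_eq by measurable

text \<open>
  At the boundary point 1 of the disc the Szego kernel is the linear function of z that produces the
  linear terms of the representation.
\<close>

lemma cayley_atom_kernel:
  assumes "cis (2 * pi * \<theta>) = 1" "Im z > 0"
  shows "2 * szego (cayley z) \<theta> = 1 - \<i> * z"
proof -
  have c: "cis (- (2 * pi * \<theta>)) = 1" by (simp only: cis_cnj[symmetric] assms(1) complex_cnj_one)
  have nz: "z + \<i> \<noteq> 0" using assms by (auto simp: complex_eq_iff)
  then have "1 - cayley z = 2 * \<i> / (z + \<i>)" by (simp add: cayley_def field_simps)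
  then have "1 / (1 - cayley z) = (z + \<i>) / (2 * \<i>)" by simp
  moreover have "2 * ((z + \<i>) / (2 * \<i>)) = 1 - \<i> * z" by (simp add: field_simps)
  ultimately show ?thesis unfolding szego_def c by simp
qed

text \<open>
  The constants come from the face masses b1 and b2 of the torus measure \<nu>, and from f (0, 0), whose
  imaginary part is - Re q (i, i).
\<close>

lemma herglotz_nevanlinna2_imp_representation:
  assumes q: "herglotz_nevanlinna2 q"
  obtains a b1 b2 :: real and \<mu> :: "(real \<times> real) measure" where "b1 \<ge> 0" "b2 \<ge> 0" "sets \<mu> = sets borel"
    "growth_condition2 \<mu>" "nevanlinna_condition2 \<mu>"
    "\<And>z1 z2. Im z1 > 0 \<Longrightarrow> Im z2 > 0 \<Longrightarrow> q (z1, z2) = of_real a + of_real b1 * z1 + of_real b2 * z2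
            + 1 / of_real (pi\<^sup>2) * (\<integral>t. kernel2 (z1, z2) t \<partial>\<mu>)"
proof -
  define f where "f w = - \<i> * q (inverse_cayley (fst w), inverse_cayley (snd w))" for w
  have f: "bidisc_holomorphic 1 f"
    unfolding f_def using q bidisc_holomorphic_cayley by (simp add: herglotz_nevanlinna2_def)
  have pos: "Re (f (w1, w2)) \<ge> 0" if "norm w1 < 1" "norm w2 < 1" for w1 w2
    using q Im_inverse_cayley that by (auto simp: f_def herglotz_nevanlinna2_def upper_half_plane2_def)
  have f_cayley: "f (cayley z1, cayley z2) = - \<i> * q (z1, z2)" if "Im z1 > 0" "Im z2 > 0" for z1 z2
    using that by (simp add: f_def inverse_cayley_cayley)
  obtain \<nu> :: "(real \<times> real) measure" where \<nu>: "finite_measure \<nu>" "sets \<nu> = sets borel"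
    and \<nu>1: "\<And>w1 w2. norm w1 < 1 \<Longrightarrow> norm w2 < 1 \<Longrightarrow>
       (\<integral>p. szego w1 (fst p) * szego w2 (snd p) \<partial>\<nu>) = (f (w1, w2) + cnj (f (0, 0))) / 2"
    and \<nu>2: "\<And>w1 w2. norm w1 < 1 \<Longrightarrow> norm w2 < 1 \<Longrightarrow>
       (\<integral>p. szego w1 (fst p) * cnj (szego w2 (snd p)) \<partial>\<nu>) = (f (w1, 0) + cnj (f (0, w2))) / 2"
    by (rule herglotz_bidisc[OF f pos]) blast+
  interpret finite_measure \<nu> by fact
  have [measurable_cong]: "sets \<nu> = sets (borel \<Otimes>\<^sub>M borel)" unfolding borel_prod by fact
  have [measurable]: "cnj \<in> borel_measurable borel"
    by (intro borel_measurable_continuous_onI continuous_intros)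
  have space: "space \<nu> = UNIV" using sets_eq_imp_space_eq[OF \<nu>(2)] by simp
  have fs[measurable]: "fst \<in> borel_measurable \<nu>" "snd \<in> borel_measurable \<nu>" by measurable

  have mixed: "(\<integral>p. (szego w1 (fst p) - 1) * cnj (szego w2 (snd p) - 1) \<partial>\<nu>) = 0"
    if "norm w1 < 1" "norm w2 < 1" for w1 w2
    by (rule mixed_moments_vanish[OF \<nu> _ that, of "\<lambda>w. f (w, 0) / 2" "\<lambda>w. cnj (f (0, w)) / 2"])
       (simp add: \<nu>2 add_divide_distrib)
  have mixed': "(\<integral>p. (szego w2 (snd p) - 1) * cnj (szego w1 (fst p) - 1) \<partial>\<nu>) = 0"
    if "norm w2 < 1" "norm w1 < 1" for w1 w2
  proof -
    have "(\<integral>p. (szego w2 (snd p) - 1) * cnj (szego w1 (fst p) - 1) \<partial>\<nu>)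
       = (\<integral>p. cnj ((szego w1 (fst p) - 1) * cnj (szego w2 (snd p) - 1)) \<partial>\<nu>)" by (simp add: mult.commute)
    also have "\<dots> = 0" unfolding Bochner_Integration.integral_cnj mixed[OF that(2,1)] by simp
    finally show ?thesis .
  qed
  \<comment> \<open>the two faces of the torus that the boundary correspondence sends to infinity\<close>
  define X1 X2 :: "real \<times> real \<Rightarrow> bool" where "X1 p \<longleftrightarrow> cis (2 * pi * fst p) = 1"
    and "X2 p \<longleftrightarrow> cis (2 * pi * snd p) = 1" for p
  have X[measurable]: "Measurable.pred \<nu> X1" "Measurable.pred \<nu> X2"
    unfolding X1_def X2_def complex_eq_iff cis.sel one_complex.sel by measurable
  have face1: "(\<integral>p. of_bool (X1 p) * (szego w (snd p) - 1) \<partial>\<nu>) = 0" if "norm w < 1" for w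
    unfolding X1_def by (rule face_mass_is_uniform(1)[OF \<nu>(1) fs _ that]) (rule mixed)
  have face2: "(\<integral>p. of_bool (X2 p) * (szego w (fst p) - 1) \<partial>\<nu>) = 0" if "norm w < 1" for w
    unfolding X2_def by (rule face_mass_is_uniform(1)[OF \<nu>(1) fs(2,1) _ that]) (rule mixed')
  have corner: "AE p in \<nu>. \<not> (X1 p \<and> X2 p)"
    unfolding X1_def X2_def by (rule face_mass_is_uniform(2)[OF \<nu>(1) fs]) (rule mixed)

  define b1 b2 where "b1 = measure \<nu> {p. X1 p}" and "b2 = measure \<nu> {p. X2 p}"
  have b: "(\<integral>p. of_bool (X1 p) \<partial>\<nu>) = complex_of_real b1" "(\<integral>p. of_bool (X2 p) \<partial>\<nu>) = complex_of_real b2"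
  proof -
    have "(\<integral>p. of_bool (P p) \<partial>\<nu>) = complex_of_real (measure \<nu> {p. P p})" if "Measurable.pred \<nu> P" for P
    proof -
      have "(\<lambda>p. of_bool (P p) :: complex) = (\<lambda>p. of_real (indicator {p. P p} p))"
        by (auto simp: fun_eq_iff indicator_def)
      then show ?thesis by (simp add: space)
    qed
    then show "(\<integral>p. of_bool (X1 p) \<partial>\<nu>) = complex_of_real b1" "(\<integral>p. of_bool (X2 p) \<partial>\<nu>) = complex_of_real b2"
      unfolding b1_def b2_def using X by auto
  qed
  define E where "E p \<longleftrightarrow> \<not> X1 p \<and> \<not> X2 p" for p
  have E[measurable]: "Measurable.pred \<nu> E" unfolding E_def by measurable
  have of_bool_int: "integrable \<nu> (\<lambda>p. of_bool (P p) * h p)" if "Measurable.pred \<nu> P" "integrable \<nu> h"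
    for P and h :: "_ \<Rightarrow> complex"
  proof (rule Bochner_Integration.integrable_bound[OF that(2)])
    note that(1)[measurable]
    have [measurable]: "h \<in> borel_measurable \<nu>" using that(2) by auto
    show "(\<lambda>p. of_bool (P p) * h p) \<in> borel_measurable \<nu>" by measurable
  qed (auto simp: norm_mult)
  \<comment> \<open>no inclusion-exclusion term occurs, because the corner is a null set\<close>
  have split: "(\<integral>p. of_bool (E p) * h p \<partial>\<nu>) = (\<integral>p. h p \<partial>\<nu>) - (\<integral>p. of_bool (X1 p) * h p \<partial>\<nu>) - (\<integral>p. of_bool (X2 p) * h p \<partial>\<nu>)"
    if h: "integrable \<nu> h" for h :: "_ \<Rightarrow> complex"
  proof -
    have [measurable]: "h \<in> borel_measurable \<nu>" using h by auto
    have "(\<integral>p. of_bool (E p) * h p \<partial>\<nu>) = (\<integral>p. h p - of_bool (X1 p) * h p - of_bool (X2 p) * h p \<partial>\<nu>)"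
    proof (rule integral_cong_AE)
      show "AE p in \<nu>. of_bool (E p) * h p = h p - of_bool (X1 p) * h p - of_bool (X2 p) * h p"
        using corner by eventually_elim (auto simp: E_def)
    qed measurable
    then show ?thesis using h of_bool_int[OF X(1) h] of_bool_int[OF X(2) h] by simp
  qed

  \<comment> \<open>the inverse of the growth weight, cut off at the faces; the factor \<open>\<pi>\<^sup>2\<close> cancels that of the theorem\<close>
  define g where "g p = pi\<^sup>2 * ((1 + (boundary_point (fst p))\<^sup>2) * (1 + (boundary_point (snd p))\<^sup>2)) * of_bool (E p)" for p
  define \<tau> where "\<tau> p = (boundary_point (fst p), boundary_point (snd p))" for p
  have g[measurable]: "g \<in> borel_measurable \<nu>" unfolding g_def by measurable
  have g_nonneg: "g p \<ge> 0" for p unfolding g_def by (intro mult_nonneg_nonneg add_nonneg_nonneg) auto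
  have \<tau>[measurable]: "\<tau> \<in> measurable \<nu> borel" unfolding \<tau>_def borel_prod[symmetric] by measurable
  define \<mu> where "\<mu> = distr (density \<nu> (\<lambda>p. ennreal (g p))) borel \<tau>"
  have transfer: "(\<integral>t. F t \<partial>\<mu>) = (\<integral>p. g p *\<^sub>R F (\<tau> p) \<partial>\<nu>)" if [measurable]: "F \<in> borel_measurable borel"
    for F :: "real \<times> real \<Rightarrow> complex"
    unfolding \<mu>_def by (subst integral_distr, simp, simp, subst integral_density) (auto simp: g_nonneg)

  have szego_int: "integrable \<nu> (\<lambda>p. szego w (fst p))" "integrable \<nu> (\<lambda>p. szego w (snd p))" if "norm w < 1" for w
    using integrable_szego[OF \<nu>(1) _ that] fs by auto
  have mult_int: "integrable \<nu> (\<lambda>p. u p * v p)"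
    if u: "u \<in> borel_measurable \<nu>" "\<And>p. norm (u p) \<le> A" and v: "integrable \<nu> v" for u v :: "_ \<Rightarrow> complex" and A
  proof (rule Bochner_Integration.integrable_bound)
    note u(1)[measurable]
    have [measurable]: "v \<in> borel_measurable \<nu>" using v by auto
    show "integrable \<nu> (\<lambda>p. A * norm (v p))" using v by simp
    show "(\<lambda>p. u p * v p) \<in> borel_measurable \<nu>" by measurable
    have "norm (u p * v p) \<le> norm (A * norm (v p))" for p
      using mult_right_mono[OF u(2)[of p], of "norm (v p)"] by (simp add: norm_mult abs_mult)
        (meson abs_ge_self mult_right_mono norm_ge_zero order_trans)
    then show "AE p in \<nu>. norm (u p * v p) \<le> norm (A * norm (v p))" by simp
  qed

  show ?thesis
  proof (rule that[of b1 b2 \<mu> "Re (q (\<i>, \<i>))"])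
    show "b1 \<ge> 0" "b2 \<ge> 0" by (simp_all add: b1_def b2_def)
    show "sets \<mu> = sets borel" by (simp add: \<mu>_def)
    show "growth_condition2 \<mu>"
    proof -
      have [measurable]: "(\<lambda>(t1, t2). ennreal (1 / ((1 + t1\<^sup>2) * (1 + t2\<^sup>2)))) \<in> borel_measurable borel"
        unfolding borel_prod[symmetric] by measurable
      have "(\<integral>\<^sup>+ (t1, t2). ennreal (1 / ((1 + t1\<^sup>2) * (1 + t2\<^sup>2))) \<partial>\<mu>)
         = (\<integral>\<^sup>+ p. ennreal (g p) * (case \<tau> p of (t1, t2) \<Rightarrow> ennreal (1 / ((1 + t1\<^sup>2) * (1 + t2\<^sup>2)))) \<partial>\<nu>)"
        unfolding \<mu>_def by (subst nn_integral_distr, simp, simp, subst nn_integral_density) auto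
      also have "\<dots> \<le> (\<integral>\<^sup>+ p. ennreal (pi\<^sup>2) \<partial>\<nu>)"
      proof (rule nn_integral_mono)
        fix p
        have "1 + (boundary_point (fst p))\<^sup>2 > 0" "1 + (boundary_point (snd p))\<^sup>2 > 0" by (auto simp: add_pos_nonneg)
        then have "g p * (1 / ((1 + (boundary_point (fst p))\<^sup>2) * (1 + (boundary_point (snd p))\<^sup>2))) \<le> pi\<^sup>2"
          unfolding g_def by (cases "E p") auto
        then show "ennreal (g p) * (case \<tau> p of (t1, t2) \<Rightarrow> ennreal (1 / ((1 + t1\<^sup>2) * (1 + t2\<^sup>2)))) \<le> ennreal (pi\<^sup>2)"
          unfolding \<tau>_def prod.case by (subst ennreal_mult'[symmetric]) (auto simp: g_nonneg intro!: ennreal_leI)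
      qed
      also have "\<dots> < \<infinity>"
      proof -
        have "emeasure \<nu> UNIV < \<infinity>" by (metis emeasure_finite infinity_ennreal_def less_top)
        then show ?thesis by (simp add: space ennreal_mult_less_top)
      qed
      finally show ?thesis unfolding growth_condition2_def .
    qed
    show "nevanlinna_condition2 \<mu>"
      unfolding nevanlinna_condition2_def
    proof clarify
      fix z1 z2 assume "(z1, z2) \<in> upper_half_plane2"
      then have z: "Im z1 > 0" "Im z2 > 0" by (auto simp: upper_half_plane2_def)
      note w = norm_cayley_less_1[OF z(1)] norm_cayley_less_1[OF z(2)]
      define s1 s2 where "s1 p = szego (cayley z1) (fst p)" and "s2 p = szego (cayley z2) (snd p)" for p :: "real \<times> real"
      define F where "F t = (1 / (of_real (fst t) - cnj z1) - 1 / (of_real (fst t) + \<i>))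
         * (1 / (of_real (snd t) - z2) - 1 / (of_real (snd t) - \<i>))" for t :: "real \<times> real"
      have F: "F \<in> borel_measurable borel" unfolding F_def borel_prod[symmetric] by measurable
      define h where "h p = cnj (s1 p - 1) * (s2 p - 1)" for p
      have h: "integrable \<nu> h" unfolding h_def
      proof (rule mult_int)
        show "(\<lambda>p. cnj (s1 p - 1)) \<in> borel_measurable \<nu>" unfolding s1_def by measurable
        show "norm (cnj (s1 p - 1)) \<le> 1 / (1 - norm (cayley z1)) + 1" for p
          unfolding complex_mod_cnj s1_def using norm_szego_le[OF w(1), of "fst p"] norm_triangle_ineq4[of "szego (cayley z1) (fst p)" 1]
          by simp
        show "integrable \<nu> (\<lambda>p. s2 p - 1)" unfolding s2_def using szego_int[OF w(2)] by simp
      qed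
      have "g p *\<^sub>R F (\<tau> p) = 4 * pi\<^sup>2 * (of_bool (E p) * h p)" for p
      proof (cases "E p")
        case True
        then show ?thesis using boundary_weight_kernels(2)[of "fst p" "snd p", OF _ _ z]
          by (simp add: g_def \<tau>_def F_def h_def s1_def s2_def E_def X1_def X2_def scaleR_conv_of_real mult.assoc)
      qed (simp add: g_def)
      then have "(\<integral>t. F t \<partial>\<mu>) = 4 * pi\<^sup>2 * (\<integral>p. of_bool (E p) * h p \<partial>\<nu>)"
        unfolding transfer[OF F] by simp
      also have "(\<integral>p. of_bool (E p) * h p \<partial>\<nu>) = 0"
      proof -
        have "(\<integral>p. h p \<partial>\<nu>) = 0"
          unfolding h_def s1_def s2_def using mixed'[OF w(2,1)] by (simp add: mult.commute)
        moreover have "(\<integral>p. of_bool (X1 p) * h p \<partial>\<nu>) = 0"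
        proof -
          have "of_bool (X1 p) * h p = cnj ((1 - \<i> * z1) / 2 - 1) * (of_bool (X1 p) * (s2 p - 1))" for p
          proof (cases "X1 p")
            case True
            then have e: "s1 p = (1 - \<i> * z1) / 2" unfolding s1_def X1_def using cayley_atom_kernel[OF _ z(1), of "fst p"] by (simp add: eq_divide_eq mult.commute)
            show ?thesis unfolding h_def e using True by simp
          qed simp
          then have "(\<integral>p. of_bool (X1 p) * h p \<partial>\<nu>) = cnj ((1 - \<i> * z1) / 2 - 1) * (\<integral>p. of_bool (X1 p) * (s2 p - 1) \<partial>\<nu>)"
            by (simp only: integral_mult_right_zero)
          then show ?thesis using face1[OF w(2)] by (simp add: s2_def)
        qed
        moreover have "(\<integral>p. of_bool (X2 p) * h p \<partial>\<nu>) = 0"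
        proof -
          have cb: "cnj (of_bool P) = of_bool P" for P by (cases P) auto
          have "of_bool (X2 p) * h p = ((1 - \<i> * z2) / 2 - 1) * cnj (of_bool (X2 p) * (s1 p - 1))" for p
          proof (cases "X2 p")
            case True
            then have e: "s2 p = (1 - \<i> * z2) / 2" unfolding s2_def X2_def using cayley_atom_kernel[OF _ z(2), of "snd p"] by (simp add: eq_divide_eq mult.commute)
            show ?thesis unfolding h_def e using True by simp
          qed simp
          then have "(\<integral>p. of_bool (X2 p) * h p \<partial>\<nu>) = ((1 - \<i> * z2) / 2 - 1) * cnj (\<integral>p. of_bool (X2 p) * (s1 p - 1) \<partial>\<nu>)"
            by (simp only: integral_mult_right_zero Bochner_Integration.integral_cnj)
          then show ?thesis using face2[OF w(1)] by (simp add: s1_def)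
        qed
        ultimately show ?thesis unfolding split[OF h] by simp
      qed
      finally have "(\<integral>t. F t \<partial>\<mu>) = 0" by simp
      moreover have "integrable \<mu> F"
      proof -
        have "integrable \<nu> (\<lambda>p. g p *\<^sub>R F (\<tau> p))"
          unfolding \<open>\<And>p. g p *\<^sub>R F (\<tau> p) = 4 * pi\<^sup>2 * (of_bool (E p) * h p)\<close>
          using of_bool_int[OF E h] by simp
        then show ?thesis unfolding \<mu>_def using F g_nonneg
          by (subst integrable_distr_eq, simp, simp, subst integrable_density) auto
      qed
      ultimately have "(\<integral>t. Re (F t) \<partial>\<mu>) = 0" by (simp add: integral_Re)
      then show "(\<integral>(t1, t2). Re ((1 / (of_real t1 - cnj z1) - 1 / (of_real t1 + \<i>))
                     * (1 / (of_real t2 - z2) - 1 / (of_real t2 - \<i>))) \<partial>\<mu>) = 0"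
        unfolding F_def case_prod_unfold .
    qed
    fix z1 z2 :: complex assume z: "Im z1 > 0" "Im z2 > 0"
    note w = norm_cayley_less_1[OF z(1)] norm_cayley_less_1[OF z(2)]
    define s1 s2 where "s1 p = szego (cayley z1) (fst p)" and "s2 p = szego (cayley z2) (snd p)" for p :: "real \<times> real"
    define h where "h p = 2 * (s1 p * s2 p) - 1" for p
    have s12: "integrable \<nu> (\<lambda>p. s1 p * s2 p)"
    proof (rule mult_int)
      show "s1 \<in> borel_measurable \<nu>" unfolding s1_def by measurable
      show "norm (s1 p) \<le> 1 / (1 - norm (cayley z1))" for p unfolding s1_def by (rule norm_szego_le[OF w(1)])
      show "integrable \<nu> s2" unfolding s2_def using szego_int[OF w(2)] by simp
    qed
    then have h: "integrable \<nu> h" unfolding h_def by simp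
    have K: "kernel2 (z1, z2) \<in> borel_measurable borel"
      unfolding kernel2_def prod.case borel_prod[symmetric] by measurable
    have "g p *\<^sub>R kernel2 (z1, z2) (\<tau> p) = (\<i> * pi\<^sup>2) * (of_bool (E p) * h p)" for p
    proof (cases "E p")
      case True
      then show ?thesis using boundary_weight_kernels(1)[of "fst p" "snd p", OF _ _ z]
        by (simp add: g_def \<tau>_def h_def s1_def s2_def E_def X1_def X2_def scaleR_conv_of_real mult.assoc)
    qed (simp add: g_def)
    then have "(\<integral>t. kernel2 (z1, z2) t \<partial>\<mu>) = (\<i> * pi\<^sup>2) * (\<integral>p. of_bool (E p) * h p \<partial>\<nu>)"
      unfolding transfer[OF K] by simp
    then have J: "1 / of_real (pi\<^sup>2) * (\<integral>t. kernel2 (z1, z2) t \<partial>\<mu>) = \<i> * (\<integral>p. of_bool (E p) * h p \<partial>\<nu>)"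
      by simp
    have one: "(\<integral>p. 1 \<partial>\<nu>) = complex_of_real (Re (f (0, 0)))"
      using \<nu>1[of 0 0] by (simp add: complex_add_cnj)
    have total: "(\<integral>p. h p \<partial>\<nu>) = f (cayley z1, cayley z2) + cnj (f (0, 0)) - Re (f (0, 0))"
    proof -
      have "(\<integral>p. h p \<partial>\<nu>) = 2 * (\<integral>p. s1 p * s2 p \<partial>\<nu>) - (\<integral>p. 1 \<partial>\<nu>)"
        unfolding h_def using s12 by (subst Bochner_Integration.integral_diff) auto
      then show ?thesis unfolding one s1_def s2_def \<nu>1[OF w] by simp
    qed
    \<comment> \<open>on a face the kernel is affine in s, the Szego kernel of the other variable\<close>
    have atom: "(\<integral>p. of_bool (P p) * h p \<partial>\<nu>) = - \<i> * z * of_real c"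
      if P: "Measurable.pred \<nu> P" "\<And>p. P p \<Longrightarrow> h p = (1 - \<i> * z) * (s p - 1) - \<i> * z"
        and s: "(\<integral>p. of_bool (P p) * (s p - 1) \<partial>\<nu>) = 0" "integrable \<nu> s"
        and c: "(\<integral>p. of_bool (P p) \<partial>\<nu>) = complex_of_real c" for P s z c
    proof -
      have "of_bool (P p) * h p = (1 - \<i> * z) * (of_bool (P p) * (s p - 1)) - \<i> * z * of_bool (P p)" for p
        using P(2)[of p] by (cases "P p") auto
      moreover have "integrable \<nu> (\<lambda>p. of_bool (P p) * (s p - 1))" by (rule of_bool_int[OF P(1)]) (use s(2) in simp)
      moreover have "integrable \<nu> (\<lambda>p. of_bool (P p) :: complex)" using of_bool_int[OF P(1), of "\<lambda>_. 1"] by simp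
      ultimately have "(\<integral>p. of_bool (P p) * h p \<partial>\<nu>) = (1 - \<i> * z) * (\<integral>p. of_bool (P p) * (s p - 1) \<partial>\<nu>) - \<i> * z * (\<integral>p. of_bool (P p) \<partial>\<nu>)"
        by simp
      then show ?thesis unfolding s c by simp
    qed
    have h1: "(\<integral>p. of_bool (X1 p) * h p \<partial>\<nu>) = - \<i> * z1 * of_real b1"
    proof (rule atom[OF X(1) _ _ _ b(1)])
      fix p assume "X1 p"
      then have "2 * s1 p = 1 - \<i> * z1" unfolding X1_def s1_def using cayley_atom_kernel z by blast
      then have "h p = (1 - \<i> * z1) * s2 p - 1" unfolding h_def by (simp add: mult.assoc[symmetric])
      then show "h p = (1 - \<i> * z1) * (s2 p - 1) - \<i> * z1" by (simp add: algebra_simps)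
    next
      show "(\<integral>p. of_bool (X1 p) * (s2 p - 1) \<partial>\<nu>) = 0" unfolding s2_def by (rule face1[OF w(2)])
      show "integrable \<nu> s2" unfolding s2_def using szego_int[OF w(2)] by simp
    qed
    have h2: "(\<integral>p. of_bool (X2 p) * h p \<partial>\<nu>) = - \<i> * z2 * of_real b2"
    proof (rule atom[OF X(2) _ _ _ b(2)])
      fix p assume "X2 p"
      then have "2 * s2 p = 1 - \<i> * z2" unfolding X2_def s2_def using cayley_atom_kernel z by blast
      then have "h p = (1 - \<i> * z2) * s1 p - 1" unfolding h_def by (simp add: mult.left_commute mult.commute)
      then show "h p = (1 - \<i> * z2) * (s1 p - 1) - \<i> * z2" by (simp add: algebra_simps)
    next
      show "(\<integral>p. of_bool (X2 p) * (s1 p - 1) \<partial>\<nu>) = 0" unfolding s1_def by (rule face2[OF w(1)])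
      show "integrable \<nu> s1" unfolding s1_def using szego_int[OF w(1)] by simp
    qed
    have f0: "f (0, 0) = - \<i> * q (\<i>, \<i>)" by (simp add: f_def inverse_cayley_def)
    have "cnj (f (0, 0)) - Re (f (0, 0)) = \<i> * Re (q (\<i>, \<i>))"
      unfolding f0 by (simp add: complex_eq_iff)
    then have t: "(\<integral>p. h p \<partial>\<nu>) = - \<i> * q (z1, z2) + \<i> * Re (q (\<i>, \<i>))"
      unfolding total f_cayley[OF z] by (simp add: algebra_simps)
    show "q (z1, z2) = of_real (Re (q (\<i>, \<i>))) + of_real b1 * z1 + of_real b2 * z2
            + 1 / of_real (pi\<^sup>2) * (\<integral>t. kernel2 (z1, z2) t \<partial>\<mu>)"
      unfolding J split[OF h] h1 h2 t by (simp add: algebra_simps)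
  qed
qed

theorem theorem3p1:
  fixes q :: "complex \<times> complex \<Rightarrow> complex"
  shows "herglotz_nevanlinna2 q \<longleftrightarrow>
    (\<exists>(a::real) (b1::real) (b2::real) (\<mu>::(real \<times> real) measure).
       b1 \<ge> 0 \<and> b2 \<ge> 0 \<and> sets \<mu> = sets borel \<and>
       growth_condition2 \<mu> \<and> nevanlinna_condition2 \<mu> \<and>
       (\<forall>(z1, z2)\<in>upper_half_plane2.
          q (z1, z2) = of_real a + of_real b1 * z1 + of_real b2 * z2
            + 1 / of_real (pi\<^sup>2) * (\<integral>t. kernel2 (z1, z2) t \<partial>\<mu>)))"
proof
  assume "herglotz_nevanlinna2 q"
  then obtain a b1 b2 \<mu> where R: "b1 \<ge> 0" "b2 \<ge> 0" "sets \<mu> = sets borel"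
    "growth_condition2 \<mu>" "nevanlinna_condition2 \<mu>"
    "\<And>z1 z2. Im z1 > 0 \<Longrightarrow> Im z2 > 0 \<Longrightarrow> q (z1, z2) = of_real a + of_real b1 * z1 + of_real b2 * z2
            + 1 / of_real (pi\<^sup>2) * (\<integral>t. kernel2 (z1, z2) t \<partial>\<mu>)"
    by (rule herglotz_nevanlinna2_imp_representation) blast
  show "\<exists>(a::real) (b1::real) (b2::real) (\<mu>::(real \<times> real) measure).
       b1 \<ge> 0 \<and> b2 \<ge> 0 \<and> sets \<mu> = sets borel \<and>
       growth_condition2 \<mu> \<and> nevanlinna_condition2 \<mu> \<and>
       (\<forall>(z1, z2)\<in>upper_half_plane2.
          q (z1, z2) = of_real a + of_real b1 * z1 + of_real b2 * z2
            + 1 / of_real (pi\<^sup>2) * (\<integral>t. kernel2 (z1, z2) t \<partial>\<mu>))"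
    by (rule exI[of _ a], rule exI[of _ b1], rule exI[of _ b2], rule exI[of _ \<mu>])
       (use R(1-5) in \<open>auto simp only: upper_half_plane2_def mem_Collect_eq case_prod_conv intro!: R(6)\<close>)
next
  assume "\<exists>(a::real) (b1::real) (b2::real) (\<mu>::(real \<times> real) measure).
       b1 \<ge> 0 \<and> b2 \<ge> 0 \<and> sets \<mu> = sets borel \<and>
       growth_condition2 \<mu> \<and> nevanlinna_condition2 \<mu> \<and>
       (\<forall>(z1, z2)\<in>upper_half_plane2.
          q (z1, z2) = of_real a + of_real b1 * z1 + of_real b2 * z2
            + 1 / of_real (pi\<^sup>2) * (\<integral>t. kernel2 (z1, z2) t \<partial>\<mu>))"
  then obtain a b1 b2 :: real and \<mu> :: "(real \<times> real) measure" where
    R: "b1 \<ge> 0" "b2 \<ge> 0" "sets \<mu> = sets borel" "growth_condition2 \<mu>" "nevanlinna_condition2 \<mu>"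
    and eq: "\<forall>(z1, z2)\<in>upper_half_plane2. q (z1, z2) = of_real a + of_real b1 * z1 + of_real b2 * z2
            + 1 / of_real (pi\<^sup>2) * (\<integral>t. kernel2 (z1, z2) t \<partial>\<mu>)"
    by blast
  show "herglotz_nevanlinna2 q"
  proof (rule representation_imp_herglotz_nevanlinna2[OF R])
    fix z1 z2 :: complex assume "Im z1 > 0" "Im z2 > 0"
    then have "(z1, z2) \<in> upper_half_plane2" by (simp add: upper_half_plane2_def)
    from bspec[OF eq this] show "q (z1, z2) = of_real a + of_real b1 * z1 + of_real b2 * z2
            + 1 / of_real (pi\<^sup>2) * (\<integral>t. kernel2 (z1, z2) t \<partial>\<mu>)" by (simp only: prod.case)
  qed
qed

end
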